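(* There is a universal constant $c_0>0$ such that the following holds. Let parameters $L_f,\Delta>0$, $\kappa_A\ge1$ be given. For any integer $k\ge\kappa_A$, set $N=\left\lfloor\frac{\kappa_A+1}2\right\rfloor$, $K=\left\lfloor\frac{k-2}{N+1}\right\rfloor+1$, $d=K+2$ and $\alpha=\sqrt{\frac{l_0\Delta}{12NdL_f}}$. Then the problem $$\min_{x\in\mathbb{R}^{2Nd}}f_0(x)=\sum_{i=1}^NG(x[i],x[N+i])\quad\text{s.t. }x[1]=x[2]=\cdots=x[2N],\qquad G(u,v)=\frac{L_f\alpha^2}{l_0}G_0\left(\frac u\alpha,\frac v\alpha\right),$$ with $G_0$ and $l_0$ as in the context, belongs to $\mathcal F_{\mathrm{NC}}(L_f,\Delta,\kappa_A)$, and for this problem with initial point $x_0=0$ the $k$-th iterate generated by any first-order linear span algorithm satisfies $$\mathrm{SubOpt}_{\mathsf{NC}}(x_k)\ge c_0\sqrt{\frac{\kappa_AL_f\Delta}k} .$$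
   Context: Here $x\in\mathbb{R}^{2Nd}$ is the stack of $x[1],\dots,x[2N]\in\mathbb{R}^d$; the constraint is written as $Ax=0$ ($b=0$) with $A\in\mathbb{R}^{(2N-1)d\times2Nd}$ the block matrix whose $i$-th block row gives $x[i]-x[i+1]$, $1\le i\le2N-1$. $G_0:\mathbb{R}^d\times\mathbb{R}^d\to\mathbb{R}$ is $$G_0(u,v)=-\Psi(1)\Phi(u_1)+\sum_{i=2}^d\left[\Psi(-v_{i-1})\Phi(-u_i)-\Psi(v_{i-1})\Phi(u_i)\right],$$ with $\Psi(x)=0$ for $x\le1/2$, $\Psi(x)=\exp\left(1-\frac1{(2x-1)^2}\right)$ for $x>1/2$, and $\Phi(x)=\sqrt e\int_{-\infty}^xe^{-t^2/2}\,\mathrm dt$. The number $l_0$ is a universal constant, independent of $d$ and all other parameters, such that $G_0$ is $l_0$-smooth (has $l_0$-Lipschitz gradient). Class $\mathcal F_{\mathrm{NC}}(L_f,\Delta,\kappa_A)$: problems $\min_xF(x)=f(x)+h(Ax-b)$ ($h$ proper closed convex; constraints $Ax=b$ correspond to $h=\mathbb I_{\{0\}}$, the indicator function of $\{0\}$) with $f$ $L_f$-smooth, $x_0\in\mathrm{dom}\,F$, $F(x_0)-\inf_xF(x)\le\Delta$, and condition number of $A$ (norm over minimal singular value) at most $\kappa_A$. For the problem in the claim, $\mathrm{SubOpt}_{\mathsf{NC}}(x):=L_f\left\|x-\mathcal P_{\mathcal X}\left(x-\frac1{2L_f}\nabla f_0(x)\right)\right\|$, where $\mathcal X=\{x\in\mathbb{R}^{2Nd}:x[1]=\cdots=x[2N]\}$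 and $\mathcal P_{\mathcal X}$ is the Euclidean projection. First-order linear span algorithm (class $\mathcal A$) for $\min f(x)$ s.t. $Ax=b$, with $x_0=0$ (and zero initial dual variable): $x_k\in\mathcal S^x_k$ for all $k$, where $\mathcal S^x_0=\mathrm{Span}\{x_0\}$ and $\mathcal S^x_{k+1}=\mathrm{Span}\{x_i,\nabla f(\hat x_i),A^{\mathrm T}(A\hat x_i-b):\hat x_i\in\mathcal S^x_i,0\le i\le k\}$. *)

theory Defs
  imports "HOL-Analysis.Analysis" "Jordan_Normal_Form.VS_Connect" "Jordan_Normal_Form.Char_Poly"
begin

text \<open>
  The dimension of the hard instance depends on its parameters while the constant of the
  lower bound does not, so Euclidean space of dimension \<open>n\<close> is \<open>carrier_vec n\<close> over the reals, with
  Euclidean norm, gradient and projection defined relative to that carrier.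
\<close>

definition euclid_norm :: "real vec \<Rightarrow> real" where
  "euclid_norm x = sqrt (scalar_prod x x)"

definition has_gradient :: "nat \<Rightarrow> (real vec \<Rightarrow> real) \<Rightarrow> real vec \<Rightarrow> real vec \<Rightarrow> bool" where
  "has_gradient n f x g \<longleftrightarrow> x \<in> carrier_vec n \<and> g \<in> carrier_vec n \<and>
     (\<forall>\<epsilon>>0. \<exists>\<delta>>0. \<forall>h\<in>carrier_vec n. euclid_norm h < \<delta> \<longrightarrow>
        \<bar>f (x + h) - f x - scalar_prod g h\<bar> \<le> \<epsilon> * euclid_norm h)"

definition gradient :: "nat \<Rightarrow> (real vec \<Rightarrow> real) \<Rightarrow> real vec \<Rightarrow> real vec" where
  "gradient n f x = (THE g. has_gradient n f x g)"

definition lip_smooth :: "nat \<Rightarrow> real \<Rightarrow> (real vec \<Rightarrow> real) \<Rightarrow> bool" where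
  "lip_smooth n L f \<longleftrightarrow>
     (\<forall>x\<in>carrier_vec n. \<exists>g. has_gradient n f x g) \<and>
     (\<forall>x\<in>carrier_vec n. \<forall>y\<in>carrier_vec n.
        euclid_norm (gradient n f x - gradient n f y) \<le> L * euclid_norm (x - y))"

definition euclid_proj :: "real vec set \<Rightarrow> real vec \<Rightarrow> real vec" where
  "euclid_proj X y = (THE p. p \<in> X \<and> (\<forall>q\<in>X. euclid_norm (y - p) \<le> euclid_norm (y - q)))"


definition operator_norm :: "real mat \<Rightarrow> real" where
  "operator_norm A = (SUP x\<in>{x \<in> carrier_vec (dim_col A). euclid_norm x \<le> 1}. euclid_norm (A *\<^sub>v x))"

text \<open>
  A matrix with \<open>m\<close> rows and \<open>n\<close> columns has \<open>min m n\<close> singular values, possibly zero: the square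
  roots of the eigenvalues of the smaller one of its two Gram matrices.
\<close>

definition singular_values :: "real mat \<Rightarrow> real set" where
  "singular_values A = {s. 0 \<le> s \<and>
     eigenvalue (if dim_row A \<le> dim_col A then A * transpose_mat A else transpose_mat A * A) (s\<^sup>2)}"

definition condition_number :: "real mat \<Rightarrow> ereal" where
  "condition_number A =
     (let \<sigma> = Min (singular_values A) in if \<sigma> = 0 then \<infinity> else ereal (operator_norm A / \<sigma>))"


definition proper_fun :: "nat \<Rightarrow> (real vec \<Rightarrow> ereal) \<Rightarrow> bool" where
  "proper_fun m h \<longleftrightarrow> (\<forall>y\<in>carrier_vec m. h y \<noteq> -\<infinity>) \<and> (\<exists>y\<in>carrier_vec m. h y \<noteq> \<infinity>)"

text \<open>Closedness of the epigraph, stated by sequences.\<close>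

definition closed_fun :: "nat \<Rightarrow> (real vec \<Rightarrow> ereal) \<Rightarrow> bool" where
  "closed_fun m h \<longleftrightarrow>
     (\<forall>Y T y t. (\<forall>i::nat. Y i \<in> carrier_vec m \<and> h (Y i) \<le> ereal (T i)) \<and> y \<in> carrier_vec m \<and>
        (\<lambda>i. euclid_norm (Y i - y)) \<longlonglongrightarrow> 0 \<and> T \<longlonglongrightarrow> t \<longrightarrow> h y \<le> ereal t)"

definition convex_fun :: "nat \<Rightarrow> (real vec \<Rightarrow> ereal) \<Rightarrow> bool" where
  "convex_fun m h \<longleftrightarrow>
     (\<forall>y\<in>carrier_vec m. \<forall>z\<in>carrier_vec m. \<forall>t. 0 < t \<and> t < 1 \<longrightarrow>
        h (t \<cdot>\<^sub>v y + (1 - t) \<cdot>\<^sub>v z) \<le> ereal t * h y + ereal (1 - t) * h z)"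

definition set_indicator :: "real vec set \<Rightarrow> real vec \<Rightarrow> ereal" where
  "set_indicator S y = (if y \<in> S then 0 else \<infinity>)"

definition composite_obj ::
  "(real vec \<Rightarrow> real) \<Rightarrow> (real vec \<Rightarrow> ereal) \<Rightarrow> real mat \<Rightarrow> real vec \<Rightarrow> real vec \<Rightarrow> ereal" where
  "composite_obj f h A b x = ereal (f x) + h (A *\<^sub>v x - b)"

definition F_NC :: "real \<Rightarrow> real \<Rightarrow> real \<Rightarrow>
    ((real vec \<Rightarrow> real) \<times> (real vec \<Rightarrow> ereal) \<times> real mat \<times> real vec \<times> real vec) set" where
  "F_NC L\<^sub>f \<Delta> \<kappa> = {(f, h, A, b, x\<^sub>0).
     b \<in> carrier_vec (dim_row A) \<and>
     proper_fun (dim_row A) h \<and> closed_fun (dim_row A) h \<and> convex_fun (dim_row A) h \<and>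
     lip_smooth (dim_col A) L\<^sub>f f \<and>
     x\<^sub>0 \<in> carrier_vec (dim_col A) \<and> composite_obj f h A b x\<^sub>0 < \<infinity> \<and>
     composite_obj f h A b x\<^sub>0 - (INF x\<in>carrier_vec (dim_col A). composite_obj f h A b x) \<le> ereal \<Delta> \<and>
     condition_number A \<le> ereal \<kappa>}"


abbreviation vec_span :: "nat \<Rightarrow> real vec set \<Rightarrow> real vec set" where
  "vec_span n S \<equiv> LinearCombinations.module.span class_ring (module_vec TYPE(real) n) S"

fun span_set :: "(real vec \<Rightarrow> real) \<Rightarrow> real mat \<Rightarrow> real vec \<Rightarrow> (nat \<Rightarrow> real vec) \<Rightarrow> nat \<Rightarrow> real vec set" where
  "span_set f A b x 0 = vec_span (dim_col A) {x 0}"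
| "span_set f A b x (Suc k) = vec_span (dim_col A)
     (\<Union>i\<in>{..k}. {x i} \<union> gradient (dim_col A) f ` span_set f A b x i \<union>
        (\<lambda>y. transpose_mat A *\<^sub>v (A *\<^sub>v y - b)) ` span_set f A b x i)"

definition linear_span_iterates ::
  "(real vec \<Rightarrow> real) \<Rightarrow> real mat \<Rightarrow> real vec \<Rightarrow> (nat \<Rightarrow> real vec) \<Rightarrow> bool" where
  "linear_span_iterates f A b x \<longleftrightarrow>
     x 0 = 0\<^sub>v (dim_col A) \<and> (\<forall>k. x k \<in> span_set f A b x k)"


definition Psi :: "real \<Rightarrow> real" where
  "Psi x = (if x \<le> 1 / 2 then 0 else exp (1 - 1 / (2 * x - 1)\<^sup>2))"

definition Phi :: "real \<Rightarrow> real" where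
  "Phi x = sqrt (exp 1) * (LBINT t:{..x}. exp (- t\<^sup>2 / 2))"

text \<open>
  Vector entries and blocks are indexed from 0, and a point \<open>(u, v)\<close> of the product of two
  \<open>d\<close>-dimensional spaces is identified with the concatenation of \<open>u\<close> and \<open>v\<close>.
\<close>

definition G0 :: "nat \<Rightarrow> real vec \<Rightarrow> real vec \<Rightarrow> real" where
  "G0 d u v = - Psi 1 * Phi (vec_index u 0) +
     (\<Sum>i=1..<d. Psi (- vec_index v (i - 1)) * Phi (- vec_index u i)
                 - Psi (vec_index v (i - 1)) * Phi (vec_index u i))"

definition G0_smooth :: "nat \<Rightarrow> real \<Rightarrow> bool" where
  "G0_smooth d l\<^sub>0 \<longleftrightarrow> lip_smooth (2 * d) l\<^sub>0 (\<lambda>w. G0 d (vec_first w d) (vec_last w d))"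

definition G :: "nat \<Rightarrow> real \<Rightarrow> real \<Rightarrow> real \<Rightarrow> real vec \<Rightarrow> real vec \<Rightarrow> real" where
  "G d l\<^sub>0 L\<^sub>f \<alpha> u v = L\<^sub>f * \<alpha>\<^sup>2 / l\<^sub>0 * G0 d ((1 / \<alpha>) \<cdot>\<^sub>v u) ((1 / \<alpha>) \<cdot>\<^sub>v v)"

definition block :: "nat \<Rightarrow> real vec \<Rightarrow> nat \<Rightarrow> real vec" where
  "block d x i = vec d (\<lambda>j. vec_index x (i * d + j))"

definition hard_obj :: "nat \<Rightarrow> nat \<Rightarrow> real \<Rightarrow> real \<Rightarrow> real \<Rightarrow> real vec \<Rightarrow> real" where
  "hard_obj N d l\<^sub>0 L\<^sub>f \<alpha> x = (\<Sum>i<N. G d l\<^sub>0 L\<^sub>f \<alpha> (block d x i) (block d x (N + i)))"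

definition consensus_set :: "nat \<Rightarrow> nat \<Rightarrow> real vec set" where
  "consensus_set N d = {x \<in> carrier_vec (2 * N * d). \<forall>i<2 * N. block d x i = block d x 0}"

definition consensus_mat :: "nat \<Rightarrow> nat \<Rightarrow> real mat" where
  "consensus_mat N d = mat ((2 * N - 1) * d) (2 * N * d)
     (\<lambda>(r, c). if c = r then 1 else if c = r + d then - 1 else 0)"

lemma consensus_mat_block:
  assumes "x \<in> carrier_vec (2 * N * d)" and "i < 2 * N - 1"
  shows "block d (consensus_mat N d *\<^sub>v x) i = block d x i - block d x (i + 1)"
proof (rule eq_vecI)
  fix j assume "j < dim_vec (block d x i - block d x (i + 1))"
  then have j: "j < d" by (simp add: block_def)
  let ?r = "i * d + j"
  have "?r < i * d + d" using j by simp
  also have "i * d + d = (i + 1) * d" by simp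
  also have "(i + 1) * d \<le> (2 * N - 1) * d" using assms(2) by (intro mult_right_mono) auto
  finally have r: "?r < (2 * N - 1) * d" .
  moreover have "(2 * N - 1) * d + d = 2 * N * d"
    using assms(2) by (cases N) (auto simp: algebra_simps)
  ultimately have rd: "?r < 2 * N * d" "?r + d < 2 * N * d" by linarith+
  have "vec_index (consensus_mat N d *\<^sub>v x) ?r
      = (\<Sum>c<2 * N * d. (if c = ?r then 1 else if c = ?r + d then - 1 else 0) * vec_index x c)"
    using r assms(1)
    by (auto simp: consensus_mat_def scalar_prod_def atLeast0LessThan intro!: sum.cong)
  also have "\<dots> = (\<Sum>c<2 * N * d. (if c = ?r then vec_index x c else 0)
                             - (if c = ?r + d then vec_index x c else 0))"
    using j by (intro sum.cong) auto
  also have "\<dots> = vec_index x ?r - vec_index x (?r + d)"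
    using rd by (simp add: sum_subtractf)
  finally show "vec_index (block d (consensus_mat N d *\<^sub>v x) i) j
      = vec_index (block d x i - block d x (i + 1)) j"
    using j by (simp add: block_def algebra_simps)
qed (simp add: block_def)

definition SubOpt_NC :: "nat \<Rightarrow> real \<Rightarrow> (real vec \<Rightarrow> real) \<Rightarrow> real vec set \<Rightarrow> real vec \<Rightarrow> real" where
  "SubOpt_NC n L\<^sub>f f X x =
     L\<^sub>f * euclid_norm (x - euclid_proj X (x - (1 / (2 * L\<^sub>f)) \<cdot>\<^sub>v gradient n f x))"

end

theory Submission
  imports Defs "HOL-Probability.Distributions"
begin

unbundle no vec_syntax

text \<open>
  \<open>G\<^sub>0\<close> is a sum of functions of the separate pairs \<open>(u\<^sub>i, v\<^sub>i\<^sub>-\<^sub>1)\<close> with bounded second derivatives, so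
  its gradient is Lipschitz uniformly in \<open>d\<close>. The Gram matrix of the constraints is the Dirichlet
  Laplacian of a path with \<open>2 N - 1\<close> interior vertices, whose condition number is at most \<open>(2 N - 1)\<^sup>2\<close>.

  A coordinate \<open>q + 1\<close> first appears in a block \<open>i < N\<close> after coordinate \<open>q\<close> has appeared in block
  \<open>N + i\<close>, and information moves along the path by one block per iteration. Hence after \<open>k\<close> iterations
  the last coordinate still vanishes in every block. At a consensus point with that property the gradient
  of \<open>u \<mapsto> G\<^sub>0(u, u)\<close> has an entry of modulus at least 1; since the gradient is Lipschitz, replacing
  \<open>x\<close> by its projection onto the consensus space changes the bound only by a constant factor.
\<close>

subsection \<open>Euclidean norm, gradients and blocks\<close>

text \<open>The constants come from one budget. Every summand of \<open>G0\<close> is at least -12,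
  because \<open>Psi\<close> is at most e and e * \<open>Phi\<close> is at most 12; so the objective
  drops by at most 12 N d L \<alpha>\<open>\<^sup>2\<close> / l, and \<alpha> is chosen to make this
  exactly \<Delta>. The gradient at a consensus point has size L \<alpha> / l in each pair of
  blocks, so the squared measure is of order N (L \<alpha> / l)\<open>\<^sup>2\<close>, that is L
  \<Delta> / (l d): N cancels, and the rate comes from d alone. Since N is about \<kappa> / 2 and
  every coordinate costs N + 1 steps, d of order k / \<kappa> suffices to keep the last coordinate
  out of reach. Conditioning leaves no constant to spare: 2 N - 1 can equal \<kappa>, so the bounds
  on the norm and on the singular values must fit together exactly. The Lipschitz estimate and the
  lower bound are carried out for an arbitrary admissible smoothness constant \<open>l\<close>; the
  explicit constant built from \<open>dbound\<close> shows that one exists and controls the Taylor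
  remainders.\<close>

lemma euclid_norm_sq:
  assumes "x \<in> carrier_vec n"
  shows "(euclid_norm x)\<^sup>2 = (\<Sum>i<n. (x $ i)\<^sup>2)"
proof -
  have "scalar_prod x x = (\<Sum>i<n. (x $ i)\<^sup>2)"
    using assms by (auto simp: scalar_prod_def atLeast0LessThan power2_eq_square)
  moreover have "0 \<le> (\<Sum>i<n. (x $ i)\<^sup>2)" by (intro sum_nonneg) auto
  ultimately show ?thesis by (simp add: euclid_norm_def)
qed

lemma euclid_norm_L2_set:
  assumes "x \<in> carrier_vec n"
  shows "euclid_norm x = L2_set (vec_index x) {..<n}"
  using assms
  by (auto simp: euclid_norm_def L2_set_def scalar_prod_def atLeast0LessThan power2_eq_square)

lemma euclid_norm_nonneg [simp]: "0 \<le> euclid_norm x"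
  by (simp add: euclid_norm_def scalar_prod_def sum_nonneg)

lemma euclid_norm_eq_0_iff:
  assumes "x \<in> carrier_vec n"
  shows "euclid_norm x = 0 \<longleftrightarrow> x = 0\<^sub>v n"
proof -
  have "euclid_norm x = 0 \<longleftrightarrow> (\<forall>i<n. x $ i = 0)"
    unfolding euclid_norm_L2_set[OF assms] by (subst L2_set_eq_0_iff) auto
  also have "\<dots> \<longleftrightarrow> x = 0\<^sub>v n" using assms by (auto intro!: eq_vecI)
  finally show ?thesis .
qed

lemma euclid_norm_zero [simp]: "euclid_norm (0\<^sub>v n) = 0"
  by (simp add: euclid_norm_def)

lemma euclid_norm_smult:
  "euclid_norm (c \<cdot>\<^sub>v x) = \<bar>c\<bar> * euclid_norm x"
proof -
  have "scalar_prod (c \<cdot>\<^sub>v x) (c \<cdot>\<^sub>v x) = c\<^sup>2 * scalar_prod x x"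
    by (simp add: scalar_prod_def sum_distrib_left power2_eq_square mult_ac)
  then show ?thesis by (simp add: euclid_norm_def real_sqrt_mult)
qed

lemma scalar_prod_self_euclid_norm: "scalar_prod x x = (euclid_norm x)\<^sup>2"
  by (simp add: euclid_norm_def scalar_prod_def sum_nonneg)

lemma euclid_norm_minus_commute:
  assumes "x \<in> carrier_vec n" "y \<in> carrier_vec n"
  shows "euclid_norm (x - y) = euclid_norm (y - x)"
proof -
  have "x - y = (-1) \<cdot>\<^sub>v (y - x)" using assms by (intro eq_vecI) auto
  then show ?thesis by (simp add: euclid_norm_smult)
qed

text \<open>\<open>gradient\<close> is a definite description, so it can be computed only after
  uniqueness. The two expansions are compared along the difference of the candidates: with e a
  quarter of its norm, the two errors together reach only half of the linear term.\<close>

lemma has_gradient_unique: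
  assumes "has_gradient n f x g" and "has_gradient n f x g'"
  shows "g = g'"
proof (rule ccontr)
  assume ne: "g \<noteq> g'"
  have car: "g \<in> carrier_vec n" "g' \<in> carrier_vec n"
    using assms by (auto simp: has_gradient_def)
  let ?d = "g - g'"
  have d: "?d \<in> carrier_vec n" using car by simp
  have "?d \<noteq> 0\<^sub>v n"
  proof
    assume "?d = 0\<^sub>v n"
    have "g $ i = g' $ i" if "i < n" for i
      using arg_cong[OF \<open>?d = 0\<^sub>v n\<close>, of "\<lambda>v. v $ i"] that car by simp
    with car ne show False by (auto intro!: eq_vecI)
  qed
  then have pos: "euclid_norm ?d > 0"
    using euclid_norm_eq_0_iff[OF d] euclid_norm_nonneg[of ?d] by linarith
  define e where "e = euclid_norm ?d / 4"
  have "e > 0" using pos by (simp add: e_def)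
  obtain r1 where r1: "r1 > 0" "\<And>h. h \<in> carrier_vec n \<Longrightarrow> euclid_norm h < r1 \<Longrightarrow>
      \<bar>f (x + h) - f x - scalar_prod g h\<bar> \<le> e * euclid_norm h"
    using assms(1) \<open>e > 0\<close> unfolding has_gradient_def by blast
  obtain r2 where r2: "r2 > 0" "\<And>h. h \<in> carrier_vec n \<Longrightarrow> euclid_norm h < r2 \<Longrightarrow>
      \<bar>f (x + h) - f x - scalar_prod g' h\<bar> \<le> e * euclid_norm h"
    using assms(2) \<open>e > 0\<close> unfolding has_gradient_def by blast
  define t where "t = min r1 r2 / (2 * euclid_norm ?d)"
  have t: "t > 0" using r1(1) r2(1) pos by (simp add: t_def)
  let ?h = "t \<cdot>\<^sub>v ?d"
  have nh: "euclid_norm ?h = min r1 r2 / 2" "euclid_norm ?h = t * euclid_norm ?d"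
    using t pos r1(1) r2(1) by (simp_all add: euclid_norm_smult t_def)
  have h: "?h \<in> carrier_vec n" using d by simp
  have "euclid_norm ?h < r1" "euclid_norm ?h < r2" using nh(1) r1(1) r2(1) by linarith+
  then have "\<bar>scalar_prod g ?h - scalar_prod g' ?h\<bar> \<le> 2 * (e * euclid_norm ?h)"
    using r1(2)[OF h] r2(2)[OF h] by linarith
  moreover have "scalar_prod g ?h - scalar_prod g' ?h = scalar_prod ?d ?h"
    using minus_scalar_prod_distrib[OF car h] by simp
  moreover have "scalar_prod ?d ?h = t * (euclid_norm ?d)\<^sup>2"
    using d by (simp add: scalar_prod_self_euclid_norm)
  ultimately have "t * (euclid_norm ?d)\<^sup>2 \<le> 2 * (euclid_norm ?d / 4 * (t * euclid_norm ?d))"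
    using t nh(2) by (simp add: e_def)
  then show False using t pos by (simp add: power2_eq_square)
qed

lemma gradient_eq:
  assumes "has_gradient n f x g"
  shows "gradient n f x = g"
  unfolding gradient_def using assms has_gradient_unique by blast

text \<open>Every gradient below is obtained from a Taylor remainder that is quadratic for all
  increments, so no neighbourhoods need to be tracked.\<close>

lemma has_gradient_quadratic:
  assumes "x \<in> carrier_vec n" and "g \<in> carrier_vec n"
    and bound: "\<And>h. h \<in> carrier_vec n \<Longrightarrow>
      \<bar>f (x + h) - f x - scalar_prod g h\<bar> \<le> C * (euclid_norm h)\<^sup>2"
  shows "has_gradient n f x g"
  unfolding has_gradient_def
proof (intro conjI allI impI)
  fix e :: real assume e: "e > 0"
  define r where "r = e / (\<bar>C\<bar> + 1)"
  have "\<bar>f (x + h) - f x - scalar_prod g h\<bar> \<le> e * euclid_norm h"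
    if h: "h \<in> carrier_vec n" "euclid_norm h < r" for h
  proof -
    have "C * euclid_norm h \<le> (\<bar>C\<bar> + 1) * euclid_norm h"
      by (intro mult_right_mono) auto
    also have "\<dots> \<le> e" using h(2) by (simp add: r_def field_simps)
    finally have "C * euclid_norm h * euclid_norm h \<le> e * euclid_norm h"
      by (intro mult_right_mono) auto
    with bound[OF h(1)] show ?thesis by (simp add: power2_eq_square)
  qed
  moreover have "r > 0" using e by (simp add: r_def)
  ultimately show "\<exists>\<delta>>0. \<forall>h\<in>carrier_vec n. euclid_norm h < \<delta> \<longrightarrow>
      \<bar>f (x + h) - f x - scalar_prod g h\<bar> \<le> e * euclid_norm h" by blast
qed (use assms(1,2) in auto)

section \<open>Block coordinates\<close>

lemma sum_blocks:
  fixes f :: "nat \<Rightarrow> real"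
  shows "(\<Sum>m<n * d. f m) = (\<Sum>b<n. \<Sum>q<d. f (b * d + q))"
proof -
  have "(\<Sum>m<n * d. f m) = (\<Sum>b<n. sum f {b * d..<b * d + d})"
    by (rule sum.nat_group[symmetric])
  also have "\<dots> = (\<Sum>b<n. \<Sum>q<d. f (b * d + q))"
  proof (rule sum.cong)
    fix b
    show "sum f {b * d..<b * d + d} = (\<Sum>q<d. f (b * d + q))"
      using sum.shift_bounds_nat_ivl[of f 0 "b * d" d] by (simp add: atLeast0LessThan add.commute)
  qed simp
  finally show ?thesis .
qed

lemma block_index_less: "b < n \<Longrightarrow> q < d \<Longrightarrow> b * d + q < n * (d::nat)"
proof -
  assume "b < n" "q < d"
  then have "b * d + q < (b + 1) * d" by simp
  also have "\<dots> \<le> n * d" using \<open>b < n\<close> by (intro mult_right_mono) auto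
  finally show ?thesis .
qed

lemma dim_block [simp]: "dim_vec (block d x i) = d" by (simp add: block_def)

lemma block_carrier [simp]: "block d x i \<in> carrier_vec d" by (simp add: block_def)

lemma block_index [simp]: "q < d \<Longrightarrow> block d x i $ q = x $ (i * d + q)" by (simp add: block_def)

lemma eq_vec_blocksI:
  fixes x y :: "real vec"
  assumes "x \<in> carrier_vec (n * d)" "y \<in> carrier_vec (n * d)"
    and "\<And>b q. b < n \<Longrightarrow> q < d \<Longrightarrow> x $ (b * d + q) = y $ (b * d + q)"
  shows "x = y"
proof (rule eq_vecI)
  fix m assume "m < dim_vec y"
  then have m: "m < n * d" using assms(2) by simp
  then have "d > 0" by (cases d) auto
  with m have "m div d < n" "m mod d < d" by (auto simp: less_mult_imp_div_less)
  from assms(3)[OF this] show "x $ m = y $ m" by (simp add: div_mult_mod_eq)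
qed (use assms in auto)

lemma euclid_norm_sq_blocks:
  assumes "x \<in> carrier_vec (n * d)"
  shows "(euclid_norm x)\<^sup>2 = (\<Sum>b<n. \<Sum>q<d. (x $ (b * d + q))\<^sup>2)"
  using euclid_norm_sq[OF assms] sum_blocks[of "\<lambda>m. (x $ m)\<^sup>2" n d] by simp

text \<open>Spans only enter through coordinates on which all generators vanish.\<close>

lemma vec_span_index_zero:
  assumes S: "S \<subseteq> carrier_vec n" and "y \<in> vec_span n S"
  shows "y \<in> carrier_vec n"
    and "m < n \<Longrightarrow> (\<And>z. z \<in> S \<Longrightarrow> z $ m = 0) \<Longrightarrow> y $ m = 0"
proof -
  interpret vec_space "TYPE(real)" n .
  obtain a T where T: "finite T" "T \<subseteq> S" and y: "y = lincomb a T"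
    using assms(2) unfolding span_def by auto
  have "T \<subseteq> carrier_vec n" using T S by auto
  then show "y \<in> carrier_vec n" unfolding y by (intro lincomb_closed) (auto simp: class_ring_simps)
  assume "m < n" "\<And>z. z \<in> S \<Longrightarrow> z $ m = 0"
  with T \<open>T \<subseteq> carrier_vec n\<close> show "y $ m = 0"
    unfolding y by (subst lincomb_index) (auto intro!: sum.neutral)
qed

subsection \<open>The scalar functions\<close>

definition dPsi :: "real \<Rightarrow> real" where
  "dPsi x = (if x \<le> 1 / 2 then 0 else exp (1 - 1 / (2 * x - 1)\<^sup>2) * 4 / (2 * x - 1) ^ 3)"

definition ddPsi :: "real \<Rightarrow> real" where
  "ddPsi x = (if x \<le> 1 / 2 then 0
     else exp (1 - 1 / (2 * x - 1)\<^sup>2) * (16 / (2 * x - 1) ^ 6 - 24 / (2 * x - 1) ^ 4))"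

definition dPhi :: "real \<Rightarrow> real" where
  "dPhi x = sqrt (exp 1) * exp (- x\<^sup>2 / 2)"

text \<open>Serves the gluing point 1/2, where \<open>Psi\<close> and \<open>dPsi\<close> change
  formula and the rules of differentiation do not apply.\<close>

lemma DERIV_zero_quadratic:
  fixes f :: "real \<Rightarrow> real"
  assumes "r > 0" and bound: "\<And>x. \<bar>x - a\<bar> < r \<Longrightarrow> \<bar>f x\<bar> \<le> C * (x - a)\<^sup>2"
  shows "DERIV f a :> 0"
proof -
  have f0: "f a = 0" using bound[of a] assms(1) by simp
  have "((\<lambda>h. (f (a + h) - f a) / h) \<longlongrightarrow> 0) (at 0)"
  proof (rule Lim_null_comparison)
    have "\<forall>\<^sub>F h in at 0. \<bar>h\<bar> < r \<and> h \<noteq> 0"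
      unfolding eventually_at using assms(1) by (intro exI[of _ r]) (auto simp: dist_real_def)
    then show "\<forall>\<^sub>F h in at 0. norm ((f (a + h) - f a) / h) \<le> C * \<bar>h\<bar>"
    proof eventually_elim
      case (elim h)
      have "\<bar>f (a + h)\<bar> \<le> C * \<bar>h\<bar> * \<bar>h\<bar>"
        using bound[of "a + h"] elim by (simp add: power2_eq_square mult.assoc)
      then show ?case using elim f0 by (simp add: field_simps)
    qed
    have "((\<lambda>h. C * \<bar>h\<bar>) \<longlongrightarrow> C * \<bar>0\<bar>) (at 0)" by (intro tendsto_intros)
    then show "((\<lambda>h. C * \<bar>h\<bar>) \<longlongrightarrow> 0) (at (0::real))" by simp
  qed
  then show ?thesis by (simp add: DERIV_def)
qed

text \<open>All powers of \<open>1 / y\<close> in the derivatives of \<open>Psi\<close> are absorbed by this flatness estimate.\<close>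

lemma exp_flat_bounds:
  fixes y :: real
  assumes "y > 0"
  shows "exp (1 - 1 / y\<^sup>2) \<le> 81 * y ^ 6" and "exp (1 - 1 / y\<^sup>2) \<le> 3"
proof -
  define t where "t = 1 / y\<^sup>2"
  have t: "t > 0" using assms by (simp add: t_def)
  \<comment> \<open>The third power of t = 1 / y\<open>\<^sup>2\<close> gives
    y\<open>\<^sup>6\<close>, the highest power of 1 / y occurring in \<open>ddPsi\<close>; 27 comes
    from the cube of 3, and the bound 3 for e turns it into 81.\<close>
  have "(t / 3) ^ 3 \<le> (1 + t / 3) ^ 3" using t by (intro power_mono) auto
  also have "\<dots> \<le> exp t" using exp_ge_one_plus_x_over_n_power_n[of 3 t] t by simp
  finally have "exp (- t) \<le> 27 / t ^ 3"
    using t by (simp add: exp_minus field_simps)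
  also have "\<dots> = 27 * y ^ 6" using assms by (simp add: t_def field_simps flip: power_mult)
  finally have "exp 1 * exp (- t) \<le> 3 * (27 * y ^ 6)"
    using exp_le by (intro mult_mono) auto
  moreover have "exp (1 - 1 / y\<^sup>2) = exp 1 * exp (- t)" by (simp add: t_def flip: exp_add)
  ultimately show "exp (1 - 1 / y\<^sup>2) \<le> 81 * y ^ 6" by simp
  have "exp (1 - 1 / y\<^sup>2) \<le> exp 1" by simp
  then show "exp (1 - 1 / y\<^sup>2) \<le> 3" using exp_le by linarith
qed

lemma Psi_nonneg: "0 \<le> Psi x" by (simp add: Psi_def)

lemma Psi_le_exp1: "Psi x \<le> exp 1" by (simp add: Psi_def)

lemma Psi_ge_1: "x \<ge> 1 \<Longrightarrow> Psi x \<ge> 1"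
proof -
  assume x: "x \<ge> 1"
  then have "(2 * x - 1)\<^sup>2 \<ge> 1" by (intro one_le_power) simp
  then have "1 / (2 * x - 1)\<^sup>2 \<le> 1" by (subst divide_le_eq_1) auto
  then show ?thesis using x by (simp add: Psi_def)
qed

lemma Psi_0 [simp]: "Psi 0 = 0" and Psi_1 [simp]: "Psi 1 = 1"
  by (simp_all add: Psi_def)

lemma dPsi_nonneg: "0 \<le> dPsi x" by (simp add: dPsi_def)

lemma dPsi_0 [simp]: "dPsi 0 = 0" by (simp add: dPsi_def)

lemma dPsi_le_cube: "1 / 2 < x \<Longrightarrow> dPsi x \<le> 324 * (2 * x - 1) ^ 3"
proof -
  assume x: "1 / 2 < x"
  let ?y = "2 * x - 1"
  have "dPsi x \<le> 81 * ?y ^ 6 * 4 / ?y ^ 3"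
    using x exp_flat_bounds(1)[of ?y] by (simp add: dPsi_def divide_right_mono)
  also have "\<dots> = 324 * ?y ^ 3" using x by (simp add: field_simps flip: power_add)
  finally show ?thesis .
qed

lemma dPsi_bound: "\<bar>dPsi x\<bar> \<le> 324"
proof (cases "1 / 2 < x")
  case True
  let ?y = "2 * x - 1"
  have "dPsi x \<le> 324"
  proof (cases "?y \<le> 1")
    case y: True
    have "?y ^ 3 \<le> 1" using y True by (intro power_le_one) auto
    then show ?thesis using dPsi_le_cube[OF True] by linarith
  next
    case y: False
    have "exp (1 - 1 / ?y\<^sup>2) * 4 / ?y ^ 3 \<le> (3 * 4) / 1"
      using exp_flat_bounds(2)[of ?y] y True by (intro frac_le) (auto intro: one_le_power)
    then show ?thesis using True by (simp add: dPsi_def)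
  qed
  then show ?thesis using dPsi_nonneg[of x] by simp
qed (simp add: dPsi_def)

text \<open>For y at most 1 the flatness estimate cancels 1 / y\<open>\<^sup>6\<close>, leaving 81 *
  (16 + 24) = 3240; for larger y all negative powers are at most 1 and the bound 3 on the
  exponential is enough.\<close>

lemma ddPsi_bound: "\<bar>ddPsi x\<bar> \<le> 3240"
proof (cases "1 / 2 < x")
  case True
  define y where "y = 2 * x - 1"
  have y: "y > 0" using True by (simp add: y_def)
  have dd: "ddPsi x = exp (1 - 1 / y\<^sup>2) * (16 / y ^ 6 - 24 / y ^ 4)"
    using True by (simp add: ddPsi_def y_def)
  have abs: "\<bar>ddPsi x\<bar> \<le> exp (1 - 1 / y\<^sup>2) * (16 / y ^ 6 + 24 / y ^ 4)"
    unfolding dd abs_mult using y by (intro mult_mono) (auto simp: abs_le_iff)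
  show ?thesis
  proof (cases "y \<le> 1")
    case True
    have "y ^ 6 \<le> y ^ 4" using True y by (intro power_decreasing) auto
    then have "24 / y ^ 4 \<le> 24 / y ^ 6" using y by (intro divide_left_mono) auto
    then have "\<bar>ddPsi x\<bar> \<le> exp (1 - 1 / y\<^sup>2) * (40 / y ^ 6)"
      using abs by (smt (verit) exp_gt_zero mult_left_mono add_divide_distrib)
    also have "\<dots> \<le> 81 * y ^ 6 * (40 / y ^ 6)"
      using y exp_flat_bounds(1)[OF y] by (intro mult_right_mono) auto
    also have "\<dots> = 3240" using y by simp
    finally show ?thesis .
  next
    case False
    then have "16 / y ^ 6 \<le> 16" "24 / y ^ 4 \<le> 24"
      using y one_le_power[of y] by (auto simp: field_simps)
    then have "exp (1 - 1 / y\<^sup>2) * (16 / y ^ 6 + 24 / y ^ 4) \<le> 3 * 40"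
      using y exp_flat_bounds(2)[OF y] by (intro mult_mono) auto
    then show ?thesis using abs by linarith
  qed
qed (simp add: ddPsi_def)

lemma DERIV_bump:
  assumes "x > 1 / 2"
  shows "((\<lambda>x. exp (1 - 1 / (2 * x - 1)\<^sup>2)) has_field_derivative dPsi x) (at x)"
proof -
  define y where "y = 2 * x - 1"
  have y: "y > 0" using assms by (simp add: y_def)
  have "((\<lambda>x. (2 * x - 1)\<^sup>2) has_field_derivative 4 * y) (at x)"
    by (auto intro!: derivative_eq_intros simp: y_def)
  from DERIV_inverse_fun[OF this] y
  have "((\<lambda>x. 1 - 1 / (2 * x - 1)\<^sup>2) has_field_derivative 4 / y ^ 3) (at x)"
    by (auto intro!: derivative_eq_intros simp: y_def[symmetric] divide_inverse)
      (simp add: field_simps eval_nat_numeral)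
  from DERIV_fun_exp[OF this] show ?thesis
    using assms by (simp add: dPsi_def y_def)
qed

lemma DERIV_Psi: "DERIV Psi x :> dPsi x"
proof -
  consider "x < 1 / 2" | "x = 1 / 2" | "x > 1 / 2" by linarith
  then show ?thesis
  proof cases
    case 1
    have "((\<lambda>_. 0) has_field_derivative 0) (at x)" by simp
    then have "DERIV Psi x :> 0"
      by (rule has_field_derivative_transform_within_open[where S = "{..<1 / 2}"])
        (use 1 in \<open>auto simp: Psi_def\<close>)
    then show ?thesis using 1 by (simp add: dPsi_def)
  next
    case 2
    have "DERIV Psi (1 / 2) :> 0"
    proof (rule DERIV_zero_quadratic[of "1/2" _ _ 324])
      fix z :: real assume z: "\<bar>z - 1 / 2\<bar> < 1 / 2"
      show "\<bar>Psi z\<bar> \<le> 324 * (z - 1 / 2)\<^sup>2"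
      proof (cases "z \<le> 1 / 2")
        case False
        let ?y = "2 * z - 1"
        have y: "0 < ?y" "?y \<le> 1" using z False by (auto simp: abs_if split: if_splits)
        have "Psi z \<le> 81 * ?y ^ 6" using False exp_flat_bounds(1)[OF y(1)] by (simp add: Psi_def)
        also have "\<dots> \<le> 81 * ?y ^ 2" using y by (intro mult_left_mono power_decreasing) auto
        also have "\<dots> = 324 * (z - 1 / 2)\<^sup>2" by (simp add: power2_eq_square algebra_simps)
        finally show ?thesis using Psi_nonneg[of z] by simp
      qed (simp add: Psi_def)
    qed simp
    moreover have "dPsi (1 / 2) = 0" by (simp add: dPsi_def)
    ultimately show ?thesis unfolding 2 by simp
  next
    case 3
    from DERIV_bump[OF 3]
    show ?thesis
      by (rule has_field_derivative_transform_within_open[where S = "{1 / 2<..}"])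
        (use 3 in \<open>auto simp: Psi_def\<close>)
  qed
qed

lemma DERIV_dPsi: "DERIV dPsi x :> ddPsi x"
proof -
  consider "x < 1 / 2" | "x = 1 / 2" | "x > 1 / 2" by linarith
  then show ?thesis
  proof cases
    case 1
    have "((\<lambda>_. 0) has_field_derivative 0) (at x)" by simp
    then have "DERIV dPsi x :> 0"
      by (rule has_field_derivative_transform_within_open[where S = "{..<1 / 2}"])
        (use 1 in \<open>auto simp: dPsi_def\<close>)
    then show ?thesis using 1 by (simp add: ddPsi_def)
  next
    case 2
    have "DERIV dPsi (1 / 2) :> 0"
    proof (rule DERIV_zero_quadratic[of "1/2" _ _ 1296])
      fix z :: real assume z: "\<bar>z - 1 / 2\<bar> < 1 / 2"
      show "\<bar>dPsi z\<bar> \<le> 1296 * (z - 1 / 2)\<^sup>2"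
      proof (cases "z \<le> 1 / 2")
        case False
        let ?y = "2 * z - 1"
        have y: "0 < ?y" "?y \<le> 1" using z False by (auto simp: abs_if split: if_splits)
        have "dPsi z \<le> 324 * ?y ^ 3" using False by (intro dPsi_le_cube) simp
        also have "\<dots> \<le> 324 * ?y ^ 2" using y by (intro mult_left_mono power_decreasing) auto
        also have "\<dots> = 1296 * (z - 1 / 2)\<^sup>2" by (simp add: power2_eq_square algebra_simps)
        finally show ?thesis using dPsi_nonneg[of z] by simp
      qed (simp add: dPsi_def)
    qed simp
    moreover have "ddPsi (1 / 2) = 0" by (simp add: ddPsi_def)
    ultimately show ?thesis unfolding 2 by simp
  next
    case 3
    define y where "y = 2 * x - 1"
    have y: "y > 0" using 3 by (simp add: y_def)
    let ?E = "exp (1 - 1 / y\<^sup>2)"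
    have "((\<lambda>x. exp (1 - 1 / (2 * x - 1)\<^sup>2) * 4 / (2 * x - 1) ^ 3) has_field_derivative
      ((?E * (4 / y ^ 3)) * 4 * y ^ 3 - ?E * 4 * (6 * y\<^sup>2)) / (y ^ 3 * y ^ 3)) (at x)"
    proof -
      have "((\<lambda>x. (2 * x - 1) ^ 3) has_field_derivative 6 * y\<^sup>2) (at x)"
        by (auto intro!: derivative_eq_intros simp: y_def)
      from DERIV_divide[OF DERIV_cmult_right[OF DERIV_bump[OF 3], of 4] this] y show ?thesis
        using 3 by (simp add: dPsi_def flip: y_def)
    qed
    moreover have "((?E * (4 / y ^ 3)) * 4 * y ^ 3 - ?E * 4 * (6 * y\<^sup>2)) / (y ^ 3 * y ^ 3) = ddPsi x"
    proof -
      have "(16 * E - E * 24 * y\<^sup>2) / (y ^ 3 * y ^ 3) = E * (16 / y ^ 6 - 24 / y ^ 4)" for E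
        using y by (simp add: field_simps eval_nat_numeral)
      from this[of ?E] show ?thesis using 3 y by (simp add: ddPsi_def flip: y_def) (simp add: mult_ac)
    qed
    ultimately have "((\<lambda>x. exp (1 - 1 / (2 * x - 1)\<^sup>2) * 4 / (2 * x - 1) ^ 3)
        has_field_derivative ddPsi x) (at x)" by simp
    then show ?thesis
      by (rule has_field_derivative_transform_within_open[where S = "{1 / 2<..}"])
        (use 3 in \<open>auto simp: dPsi_def\<close>)
  qed
qed

section \<open>The Gaussian primitive \<open>Phi\<close>\<close>

lemma gauss_integral:
  "integrable lborel (\<lambda>t::real. exp (- t\<^sup>2 / 2))"
  "(LBINT t. exp (- t\<^sup>2 / 2)) = sqrt (2 * pi)"
proof -
  have eq: "(\<lambda>t::real. exp (- t\<^sup>2 / 2)) = (\<lambda>t. sqrt (2 * pi) * normal_density 0 1 t)"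
    by (auto simp: normal_density_def)
  show "integrable lborel (\<lambda>t::real. exp (- t\<^sup>2 / 2))"
    unfolding eq by (intro integrable_mult_right integrable_normal_density) simp
  show "(LBINT t. exp (- t\<^sup>2 / 2)) = sqrt (2 * pi)"
    unfolding eq by (simp add: integral_normal_density)
qed

lemma gauss_set_integrable:
  "A \<in> sets borel \<Longrightarrow> set_integrable lborel A (\<lambda>t::real. exp (- t\<^sup>2 / 2))"
  unfolding set_integrable_def
  using integrable_mult_indicator[of A lborel, OF _ gauss_integral(1)] by simp

lemma Phi_nonneg: "0 \<le> Phi x"
  unfolding Phi_def set_lebesgue_integral_def by (auto intro!: integral_nonneg)

lemma Phi_le: "Phi x \<le> sqrt (exp 1) * sqrt (2 * pi)"
proof -
  have "(LBINT t:{..x}. exp (- t\<^sup>2 / 2)) \<le> (LBINT t. exp (- t\<^sup>2 / 2))"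
    unfolding set_lebesgue_integral_def
  proof (rule integral_mono)
    show "integrable lborel (\<lambda>t. indicat_real {..x} t *\<^sub>R exp (- t\<^sup>2 / 2))"
      using gauss_set_integrable[of "{..x}"] by (simp add: set_integrable_def)
    show "integrable lborel (\<lambda>t::real. exp (- t\<^sup>2 / 2))" by (rule gauss_integral(1))
  qed (auto simp: indicator_def)
  then show ?thesis
    unfolding Phi_def gauss_integral(2) by (intro mult_left_mono) auto
qed

text \<open>The bound 12 below requires e\<open>\<^sup>3\<close> * 2 pi to be at most 144, for which
  pi < 4 is too weak. If pi were at least 3.3, then sin 0.55 would be at most sin (pi / 6) = 1/2,
  but the Taylor polynomial with its error bound exceeds 0.52 there.\<close>

lemma pi_less_33_10: "pi < 33 / 10"
proof (rule ccontr)
  assume "\<not> pi < 33 / 10"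
  then have p: "11 / 20 \<le> pi / 6" by simp
  have "sin (11 / 20) \<le> sin (pi / 6)"
    using p pi_gt_zero by (intro sin_monotone_2pi_le) auto
  then have "sin (11 / 20 :: real) \<le> 1 / 2" by (simp add: sin_30)
  moreover have "\<bar>sin (11 / 20 :: real) - (\<Sum>m<5. sin_coeff m * (11 / 20) ^ m)\<bar>
      \<le> inverse (fact 5) * \<bar>11 / 20\<bar> ^ 5"
    by (rule Maclaurin_sin_bound)
  moreover have "(\<Sum>m<5. sin_coeff m * (11 / 20 :: real) ^ m) = 11 / 20 - (11 / 20) ^ 3 / 6"
  proof -
    have "{..<5} = {0, 1, 2, 3, 4::nat}" by auto
    then show ?thesis by (simp add: sin_coeff_def fact_numeral)
  qed
  ultimately show False by (simp add: abs_le_iff fact_numeral power_divide)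
qed

text \<open>The origin of the 12 in \<alpha>: as \<open>Psi\<close> is at most e, this bounds every
  product of \<open>Psi\<close> and \<open>Phi\<close> in \<open>G0\<close>.\<close>

lemma exp1_Phi_le_12: "exp 1 * Phi x \<le> 12"
proof -
  have "(exp 1 :: real) ^ 3 \<le> (272 / 100) ^ 3"
    using e_less_272 by (intro power_mono) auto
  then have "exp 1 ^ 3 * (2 * pi) \<le> (272 / 100) ^ 3 * (2 * (33 / 10))"
    using pi_less_33_10 by (intro mult_mono) auto
  also have "\<dots> \<le> 12\<^sup>2" by (simp add: power3_eq_cube)
  also have "exp 1 ^ 3 * (2 * pi) = (exp 1 * (sqrt (exp 1) * sqrt (2 * pi)))\<^sup>2"
    by (simp add: power_mult_distrib power2_eq_square[of "exp 1"] power3_eq_cube)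
  finally have "(exp 1 * (sqrt (exp 1) * sqrt (2 * pi)))\<^sup>2 \<le> 12\<^sup>2" .
  then have "exp 1 * (sqrt (exp 1) * sqrt (2 * pi)) \<le> 12"
    by (rule power2_le_imp_le) simp
  moreover have "exp 1 * Phi x \<le> exp 1 * (sqrt (exp 1) * sqrt (2 * pi))"
    using Phi_le by (intro mult_left_mono) auto
  ultimately show ?thesis by linarith
qed

text \<open>Cutting the half-line at x - 1 leaves a constant tail and an integral over a compact
  interval, to which the fundamental theorem of calculus applies.\<close>

lemma DERIV_Phi: "DERIV Phi x :> dPhi x"
proof -
  define a b where "a = x - 1" and "b = x + 1"
  let ?g = "\<lambda>t::real. exp (- t\<^sup>2 / 2)"
  have cont: "continuous_on {a..b} ?g" by (intro continuous_intros) auto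
  have "((\<lambda>z. integral {a..z} ?g) has_real_derivative ?g x) (at x within {a..b})"
    by (rule integral_has_real_derivative[OF cont]) (simp add: a_def b_def)
  then have "((\<lambda>z. integral {a..z} ?g) has_real_derivative ?g x) (at x)"
    by (subst (asm) at_within_interior) (auto simp: a_def b_def)
  then have "((\<lambda>z. sqrt (exp 1) * ((LBINT t:{..<a}. ?g t) + integral {a..z} ?g))
      has_real_derivative dPhi x) (at x)"
    unfolding dPhi_def by (auto intro!: derivative_eq_intros)
  then show ?thesis
  proof (rule has_field_derivative_transform_within_open[where S = "{a<..}"])
    fix z assume "z \<in> {a<..}"
    then have un: "{..z} = {..<a} \<union> {a..z}" by auto
    have "(LBINT t:{..z}. ?g t) = (LBINT t:{..<a}. ?g t) + (LBINT t:{a..z}. ?g t)"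
      unfolding un by (intro set_integral_Un gauss_set_integrable) auto
    also have "(LBINT t:{a..z}. ?g t) = integral {a..z} ?g"
      by (intro set_borel_integral_eq_integral(2) gauss_set_integrable) auto
    finally show "sqrt (exp 1) * ((LBINT t:{..<a}. ?g t) + integral {a..z} ?g) = Phi z"
      by (simp add: Phi_def)
  qed (auto simp: a_def)
qed

lemma DERIV_dPhi: "DERIV dPhi x :> - x * dPhi x"
  unfolding dPhi_def by (auto intro!: derivative_eq_intros)

lemma dPhi_minus [simp]: "dPhi (- x) = dPhi x" by (simp add: dPhi_def)

text \<open>The factor sqrt e in \<open>Phi\<close> normalises its slope to 1 at the points 1 and
  -1, and the slope is larger between them.\<close>

lemma dPhi_ge_1:
  assumes "\<bar>x\<bar> \<le> 1"
  shows "1 \<le> dPhi x"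
proof -
  have "x\<^sup>2 \<le> 1" using assms by (simp add: abs_square_le_1)
  then have "exp (- 1 / 2 :: real) \<le> exp (- x\<^sup>2 / 2)" by simp
  then have "sqrt (exp 1) * exp (- 1 / 2) \<le> dPhi x"
    unfolding dPhi_def by (intro mult_left_mono) auto
  moreover have "sqrt (exp 1) = exp (1 / 2 :: real)"
    by (rule real_sqrt_unique) (simp_all flip: exp_double)
  ultimately show ?thesis by (simp flip: exp_add)
qed

lemma dPhi_bounds: "\<bar>dPhi x\<bar> \<le> 2" "\<bar>- x * dPhi x\<bar> \<le> 2"
proof -
  have s: "sqrt (exp 1) \<le> (2::real)" using exp_le by (intro real_le_lsqrt) auto
  have "sqrt (exp 1) * exp (- x\<^sup>2 / 2) \<le> 2 * 1" using s by (intro mult_mono) auto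
  then show "\<bar>dPhi x\<bar> \<le> 2" by (simp add: dPhi_def)
  have "\<bar>x\<bar> \<le> 1 + x\<^sup>2 / 2"
    using zero_le_power2[of "\<bar>x\<bar> - 1"] by (simp add: power2_diff)
  also have "\<dots> \<le> exp (x\<^sup>2 / 2)" by simp
  finally have "\<bar>x\<bar> * exp (- x\<^sup>2 / 2) \<le> 1" by (simp add: exp_minus field_simps)
  then have "sqrt (exp 1) * (\<bar>x\<bar> * exp (- x\<^sup>2 / 2)) \<le> 2 * 1" using s by (intro mult_mono) auto
  then show "\<bar>- x * dPhi x\<bar> \<le> 2" by (simp add: dPhi_def abs_mult mult_ac)
qed

section \<open>Lipschitz and second-order Taylor estimates\<close>

lemma deriv_bound_lipschitz:
  fixes f f' :: "real \<Rightarrow> real"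
  assumes "\<And>x. DERIV f x :> f' x" and "\<And>x. \<bar>f' x\<bar> \<le> M"
  shows "\<bar>f x - f y\<bar> \<le> M * \<bar>x - y\<bar>"
  using field_differentiable_bound[of UNIV f f' M x y] assms by auto

lemma second_deriv_bound_taylor:
  fixes f f' f'' :: "real \<Rightarrow> real"
  assumes f: "\<And>x. DERIV f x :> f' x" and f': "\<And>x. DERIV f' x :> f'' x"
    and M: "\<And>x. \<bar>f'' x\<bar> \<le> M"
  shows "\<bar>f (a + s) - f a - f' a * s\<bar> \<le> M * s\<^sup>2"
proof -
  have "\<exists>z. \<bar>z - a\<bar> \<le> \<bar>s\<bar> \<and> f (a + s) - f a = f' z * s"
  proof -
    consider "s = 0" | "s > 0" | "s < 0" by linarith
    then show ?thesis
    proof cases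
      case 1
      then show ?thesis by (intro exI[of _ a]) auto
    next
      case 2
      obtain z where "a < z" "z < a + s" "f (a + s) - f a = (a + s - a) * f' z"
        using MVT2[of a "a + s" f f'] f 2 by auto
      then show ?thesis using 2 by (intro exI[of _ z]) auto
    next
      case 3
      obtain z where "a + s < z" "z < a" "f a - f (a + s) = (a - (a + s)) * f' z"
        using MVT2[of "a + s" a f f'] f 3 by auto
      then show ?thesis using 3 by (intro exI[of _ z]) (auto simp: algebra_simps)
    qed
  qed
  then obtain z where z: "\<bar>z - a\<bar> \<le> \<bar>s\<bar>" "f (a + s) - f a = f' z * s" by blast
  have M0: "0 \<le> M" using M[of 0] by linarith
  have "\<bar>f' z - f' a\<bar> \<le> M * \<bar>z - a\<bar>" by (rule deriv_bound_lipschitz[OF f' M])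
  also have "\<dots> \<le> M * \<bar>s\<bar>" using z(1) M0 by (rule mult_left_mono)
  finally have "\<bar>f' z - f' a\<bar> * \<bar>s\<bar> \<le> M * \<bar>s\<bar> * \<bar>s\<bar>" by (intro mult_right_mono) auto
  moreover have "f (a + s) - f a - f' a * s = (f' z - f' a) * s" using z(2) by (simp add: algebra_simps)
  ultimately show ?thesis by (simp add: abs_mult power2_eq_square mult.assoc)
qed

lemma bounded_mult_lipschitz:
  fixes f g :: "real \<Rightarrow> real"
  assumes "\<And>x. \<bar>f x\<bar> \<le> M" "\<And>x. \<bar>g x\<bar> \<le> M"
    and "\<And>x y. \<bar>f x - f y\<bar> \<le> M * \<bar>x - y\<bar>" "\<And>x y. \<bar>g x - g y\<bar> \<le> M * \<bar>x - y\<bar>"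
  shows "\<bar>f a * g b - f a' * g b'\<bar> \<le> M\<^sup>2 * (\<bar>a - a'\<bar> + \<bar>b - b'\<bar>)"
proof -
  have M0: "0 \<le> M" using assms(1)[of 0] by linarith
  have "f a * g b - f a' * g b' = (f a - f a') * g b + f a' * (g b - g b')"
    by (simp add: algebra_simps)
  also have "\<bar>\<dots>\<bar> \<le> \<bar>f a - f a'\<bar> * \<bar>g b\<bar> + \<bar>f a'\<bar> * \<bar>g b - g b'\<bar>"
    using abs_triangle_ineq by (simp add: abs_mult[symmetric])
  also have "\<dots> \<le> (M * \<bar>a - a'\<bar>) * M + M * (M * \<bar>b - b'\<bar>)"
    using assms M0 by (intro add_mono mult_mono) auto
  finally show ?thesis by (simp add: power2_eq_square algebra_simps)
qed

text \<open>The remainder of a product splits into the remainder of f times the new value of g, a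
  cross term of the two increments, and the old value of f times the remainder of g. The cross term
  is absorbed by the squares.\<close>

lemma product_taylor:
  fixes f f' f'' g g' g'' :: "real \<Rightarrow> real"
  assumes f: "\<And>x. DERIV f x :> f' x" "\<And>x. DERIV f' x :> f'' x"
    and g: "\<And>x. DERIV g x :> g' x" "\<And>x. DERIV g' x :> g'' x"
    and M: "\<And>x. \<bar>f x\<bar> \<le> M" "\<And>x. \<bar>f' x\<bar> \<le> M" "\<And>x. \<bar>f'' x\<bar> \<le> M"
      "\<And>x. \<bar>g x\<bar> \<le> M" "\<And>x. \<bar>g' x\<bar> \<le> M" "\<And>x. \<bar>g'' x\<bar> \<le> M"
  shows "\<bar>f (a + s) * g (b + t) - f a * g b - f' a * g b * s - f a * g' b * t\<bar>
    \<le> 2 * M\<^sup>2 * (s\<^sup>2 + t\<^sup>2)"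
proof -
  have M0: "0 \<le> M" using M(1)[of 0] by linarith
  let ?F = "f (a + s) - f a - f' a * s" and ?G = "g (b + t) - g b - g' b * t"
    and ?D = "g (b + t) - g b"
  have F: "\<bar>?F\<bar> \<le> M * s\<^sup>2" by (rule second_deriv_bound_taylor[OF f M(3)])
  have G: "\<bar>?G\<bar> \<le> M * t\<^sup>2" by (rule second_deriv_bound_taylor[OF g M(6)])
  have D: "\<bar>?D\<bar> \<le> M * \<bar>t\<bar>"
    using deriv_bound_lipschitz[OF g(1) M(5), of "b + t" b] by simp
  have "f (a + s) * g (b + t) - f a * g b - f' a * g b * s - f a * g' b * t
      = ?F * g (b + t) + f' a * s * ?D + f a * ?G" by (simp add: algebra_simps)
  also have "\<bar>\<dots>\<bar> \<le> \<bar>?F\<bar> * \<bar>g (b + t)\<bar> + \<bar>f' a\<bar> * \<bar>s\<bar> * \<bar>?D\<bar> + \<bar>f a\<bar> * \<bar>?G\<bar>"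
    unfolding abs_mult[symmetric] by linarith
  also have "\<dots> \<le> M * s\<^sup>2 * M + M * \<bar>s\<bar> * (M * \<bar>t\<bar>) + M * (M * t\<^sup>2)"
    using F G D M M0 by (intro add_mono mult_mono) auto
  also have "\<dots> = M\<^sup>2 * (s\<^sup>2 + t\<^sup>2 + \<bar>s\<bar> * \<bar>t\<bar>)" by (simp add: power2_eq_square algebra_simps)
  also have "\<dots> \<le> M\<^sup>2 * (2 * (s\<^sup>2 + t\<^sup>2))"
  proof (intro mult_left_mono)
    have "2 * (\<bar>s\<bar> * \<bar>t\<bar>) \<le> \<bar>s\<bar>\<^sup>2 + \<bar>t\<bar>\<^sup>2"
      using sum_squares_bound[of "\<bar>s\<bar>" "\<bar>t\<bar>"] by (simp add: mult_ac)
    moreover have "0 \<le> \<bar>s\<bar> * \<bar>t\<bar>" by simp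
    ultimately show "s\<^sup>2 + t\<^sup>2 + \<bar>s\<bar> * \<bar>t\<bar> \<le> 2 * (s\<^sup>2 + t\<^sup>2)"
      unfolding power2_abs by argo
  qed simp
  finally show ?thesis by (simp only: mult_ac)
qed

text \<open>One summand of \<open>G0\<close>, with a in the role of
  \<open>v\<^sub>i\<^sub>-\<^sub>1\<close> and b in the role of \<open>u\<^sub>i\<close>;
  \<open>link_da\<close> and \<open>link_db\<close> are its partial derivatives.\<close>

definition link :: "real \<Rightarrow> real \<Rightarrow> real" where
  "link a b = Psi (- a) * Phi (- b) - Psi a * Phi b"

definition link_da :: "real \<Rightarrow> real \<Rightarrow> real" where
  "link_da a b = - (dPsi (- a) * Phi (- b) + dPsi a * Phi b)"

definition link_db :: "real \<Rightarrow> real \<Rightarrow> real" where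
  "link_db a b = - (Psi (- a) * dPhi (- b) + Psi a * dPhi b)"

text \<open>A common bound for \<open>Psi\<close>, \<open>Phi\<close> and their first two
  derivatives; the value is that of \<open>ddPsi_bound\<close>, the largest among them.\<close>

definition dbound :: real where "dbound = 3240"

lemma dbounds:
  "\<bar>Psi x\<bar> \<le> dbound" "\<bar>dPsi x\<bar> \<le> dbound" "\<bar>ddPsi x\<bar> \<le> dbound"
  "\<bar>Phi x\<bar> \<le> dbound" "\<bar>dPhi x\<bar> \<le> dbound" "\<bar>- x * dPhi x\<bar> \<le> dbound"
proof -
  show "\<bar>Psi x\<bar> \<le> dbound" using Psi_nonneg[of x] Psi_le_exp1[of x] exp_le by (simp add: dbound_def)
  have "1 * Phi x \<le> exp 1 * Phi x" using Phi_nonneg by (intro mult_right_mono) auto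
  then show "\<bar>Phi x\<bar> \<le> dbound"
    using Phi_nonneg[of x] exp1_Phi_le_12[of x] by (simp add: dbound_def)
qed (use dPsi_bound[of x] ddPsi_bound[of x] dPhi_bounds[of x] in \<open>simp_all add: dbound_def\<close>)

lemma link_taylor:
  "\<bar>link (a + s) (b + t) - link a b - link_da a b * s - link_db a b * t\<bar>
    \<le> 4 * dbound\<^sup>2 * (s\<^sup>2 + t\<^sup>2)"
proof -
  let ?R = "\<lambda>a b s t. Psi (a + s) * Phi (b + t) - Psi a * Phi b - dPsi a * Phi b * s - Psi a * dPhi b * t"
  have R: "\<bar>?R a b s t\<bar> \<le> 2 * dbound\<^sup>2 * (s\<^sup>2 + t\<^sup>2)" for a b s t
    by (rule product_taylor[OF DERIV_Psi DERIV_dPsi DERIV_Phi DERIV_dPhi]) (rule dbounds)+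
  have "link (a + s) (b + t) - link a b - link_da a b * s - link_db a b * t
      = ?R (- a) (- b) (- s) (- t) - ?R a b s t"
    by (simp add: link_def link_da_def link_db_def algebra_simps)
  then show ?thesis using R[of a s b t] R[of "- a" "- s" "- b" "- t"] by simp
qed

text \<open>Squared, so that summation over the pairs yields squared Euclidean norms directly. A
  factor 4 stems from the two products in each partial derivative, a factor 2 from squaring a
  sum.\<close>

lemma link_da_lipschitz:
  "(link_da a b - link_da a' b')\<^sup>2 \<le> 8 * dbound ^ 4 * ((a - a')\<^sup>2 + (b - b')\<^sup>2)"
  and link_db_lipschitz:
  "(link_db a b - link_db a' b')\<^sup>2 \<le> 8 * dbound ^ 4 * ((a - a')\<^sup>2 + (b - b')\<^sup>2)"
proof -
  note lip = deriv_bound_lipschitz[OF DERIV_Psi dbounds(2)] deriv_bound_lipschitz[OF DERIV_dPsi dbounds(3)]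
    deriv_bound_lipschitz[OF DERIV_Phi dbounds(5)] deriv_bound_lipschitz[OF DERIV_dPhi dbounds(6)]
  have square: "z\<^sup>2 \<le> 8 * dbound ^ 4 * ((a - a')\<^sup>2 + (b - b')\<^sup>2)"
    if "\<bar>z\<bar> \<le> 2 * (dbound\<^sup>2 * (\<bar>a - a'\<bar> + \<bar>b - b'\<bar>))" for z
  proof -
    have "z\<^sup>2 \<le> (2 * (dbound\<^sup>2 * (\<bar>a - a'\<bar> + \<bar>b - b'\<bar>)))\<^sup>2"
      using that by (metis power2_abs power_mono abs_ge_zero)
    also have "\<dots> = 4 * dbound ^ 4 * (\<bar>a - a'\<bar> + \<bar>b - b'\<bar>)\<^sup>2"
      by (simp add: power_mult_distrib flip: power_mult)
    also have "\<dots> \<le> 4 * dbound ^ 4 * (2 * ((a - a')\<^sup>2 + (b - b')\<^sup>2))"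
    proof (intro mult_left_mono)
      show "(\<bar>a - a'\<bar> + \<bar>b - b'\<bar>)\<^sup>2 \<le> 2 * ((a - a')\<^sup>2 + (b - b')\<^sup>2)"
        using sum_squares_bound[of "\<bar>a - a'\<bar>" "\<bar>b - b'\<bar>"] by (simp add: power2_sum)
    qed simp
    finally show ?thesis by (simp add: algebra_simps)
  qed
  have da: "\<bar>dPsi a * Phi b - dPsi a' * Phi b'\<bar> \<le> dbound\<^sup>2 * (\<bar>a - a'\<bar> + \<bar>b - b'\<bar>)" for a b a' b'
    by (rule bounded_mult_lipschitz) (rule dbounds lip)+
  have db: "\<bar>Psi a * dPhi b - Psi a' * dPhi b'\<bar> \<le> dbound\<^sup>2 * (\<bar>a - a'\<bar> + \<bar>b - b'\<bar>)" for a b a' b'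
    by (rule bounded_mult_lipschitz) (rule dbounds lip)+
  show "(link_da a b - link_da a' b')\<^sup>2 \<le> 8 * dbound ^ 4 * ((a - a')\<^sup>2 + (b - b')\<^sup>2)"
    using da[of a b a' b'] da[of "- a" "- b" "- a'" "- b'"]
    
    by (intro square) (auto simp: link_da_def abs_le_iff abs_minus_commute)
  show "(link_db a b - link_db a' b')\<^sup>2 \<le> 8 * dbound ^ 4 * ((a - a')\<^sup>2 + (b - b')\<^sup>2)"
    using db[of a b a' b'] db[of "- a" "- b" "- a'" "- b'"]
    by (intro square) (auto simp: link_db_def abs_le_iff abs_minus_commute)
qed

subsection \<open>Smoothness of \<open>G\<^sub>0\<close>\<close>

definition G0_stack :: "nat \<Rightarrow> real vec \<Rightarrow> real" where
  "G0_stack d w = G0 d (vec_first w d) (vec_last w d)"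

text \<open>The entries of u come first. An entry m >= d belongs to \<open>v\<close> at position m -
  d, which is linked to \<open>u\<close> at the next position m - d + 1; this shift leaves
  derivative 0 for the last entry of v.\<close>

definition G0_grad :: "nat \<Rightarrow> real vec \<Rightarrow> real vec" where
  "G0_grad d w = vec (2 * d) (\<lambda>m.
     if m = 0 then - dPhi (w $ 0)
     else if m < d then link_db (w $ (d + m - 1)) (w $ m)
     else if m + 1 < 2 * d then link_da (w $ m) (w $ (m + 1 - d))
     else 0)"

lemma G0_grad_carrier [simp]: "G0_grad d w \<in> carrier_vec (2 * d)"
  by (simp add: G0_grad_def)

lemma dim_G0_grad [simp]: "dim_vec (G0_grad d w) = 2 * d"
  by (simp add: G0_grad_def)

lemma G0_grad_index:
  shows "1 \<le> d \<Longrightarrow> G0_grad d w $ 0 = - dPhi (w $ 0)"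
    and "1 \<le> i \<Longrightarrow> i < d \<Longrightarrow> G0_grad d w $ i = link_db (w $ (d + i - 1)) (w $ i)"
    and "1 \<le> i \<Longrightarrow> i < d \<Longrightarrow> G0_grad d w $ (d + i - 1) = link_da (w $ (d + i - 1)) (w $ i)"
    and "1 \<le> d \<Longrightarrow> G0_grad d w $ (2 * d - 1) = 0"
proof -
  assume i: "1 \<le> i" "i < d"
  then have "d + i - 1 + 1 - d = i" "\<not> d + i - 1 < d" "d + i - 1 + 1 < 2 * d" by auto
  then show "G0_grad d w $ (d + i - 1) = link_da (w $ (d + i - 1)) (w $ i)"
    using i by (simp add: G0_grad_def del: Nat.add_diff_assoc2 One_nat_def)
qed (auto simp: G0_grad_def)

lemma G0_stack_link:
  assumes "w \<in> carrier_vec (2 * d)" "1 \<le> d"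
  shows "G0_stack d w = - Phi (w $ 0) + (\<Sum>i=1..<d. link (w $ (d + i - 1)) (w $ i))"
  using assms unfolding G0_stack_def G0_def link_def vec_first_def vec_last_def
  by (auto intro!: sum.cong)

text \<open>The coordinates of \<open>(u, v)\<close> grouped as \<open>u\<^sub>0\<close>, the pairs \<open>(u\<^sub>i, v\<^sub>i\<^sub>-\<^sub>1)\<close> and the unused \<open>v\<^sub>d\<^sub>-\<^sub>1\<close>.\<close>

lemma sum_linked_pairs:
  fixes F :: "nat \<Rightarrow> real"
  assumes "1 \<le> d"
  shows "(\<Sum>m<2 * d. F m) = F 0 + (\<Sum>i=1..<d. F i + F (d + i - 1)) + F (2 * d - 1)"
proof -
  obtain e where e: "d = Suc e" using assms by (cases d) auto
  have "(\<Sum>m<2 * d. F m) = (\<Sum>m<d. F m) + (\<Sum>m<d. F (d + m))"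
    using sum_blocks[of F 2 d] by (simp add: numeral_2_eq_2)
  also have "(\<Sum>m<d. F m) = F 0 + (\<Sum>i<e. F (Suc i))"
    unfolding e by (rule sum.lessThan_Suc_shift)
  also have "(\<Sum>m<d. F (d + m)) = (\<Sum>i<e. F (d + i)) + F (2 * d - 1)"
    by (simp add: e mult_2)
  also have "(\<Sum>i<e. F (Suc i)) = (\<Sum>i=1..<d. F i)"
    unfolding e using sum.shift_bounds_Suc_ivl[of F 0 e] by (simp add: atLeast0LessThan)
  also have "(\<Sum>i<e. F (d + i)) = (\<Sum>i=1..<d. F (d + i - 1))"
    unfolding e using sum.shift_bounds_Suc_ivl[of "\<lambda>i. F (Suc e + i - 1)" 0 e]
    by (simp add: atLeast0LessThan)
  finally show ?thesis by (simp add: sum.distrib)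
qed

lemma G0_stack_taylor:
  assumes w: "w \<in> carrier_vec (2 * d)" and h: "h \<in> carrier_vec (2 * d)" and d: "1 \<le> d"
  shows "\<bar>G0_stack d (w + h) - G0_stack d w - scalar_prod (G0_grad d w) h\<bar>
    \<le> 4 * dbound\<^sup>2 * (euclid_norm h)\<^sup>2"
proof -
  let ?a = "\<lambda>i. w $ (d + i - 1)" and ?b = "\<lambda>i. w $ i"
  let ?s = "\<lambda>i. h $ (d + i - 1)" and ?t = "\<lambda>i. h $ i"
  let ?R = "\<lambda>i. link (?a i + ?s i) (?b i + ?t i) - link (?a i) (?b i)
    - link_da (?a i) (?b i) * ?s i - link_db (?a i) (?b i) * ?t i"
  let ?P = "Phi (w $ 0 + h $ 0) - Phi (w $ 0) - dPhi (w $ 0) * h $ 0"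
  have "scalar_prod (G0_grad d w) h = (\<Sum>m<2 * d. G0_grad d w $ m * h $ m)"
    using h by (simp add: scalar_prod_def atLeast0LessThan)
  also have "\<dots> = - dPhi (w $ 0) * h $ 0
      + (\<Sum>i=1..<d. G0_grad d w $ i * ?t i + G0_grad d w $ (d + i - 1) * ?s i)"
    unfolding sum_linked_pairs[OF d] G0_grad_index(1)[OF d] G0_grad_index(4)[OF d]
    by (simp only: mult_zero_left add_0_right)
  also have "(\<Sum>i=1..<d. G0_grad d w $ i * ?t i + G0_grad d w $ (d + i - 1) * ?s i)
      = (\<Sum>i=1..<d. link_db (?a i) (?b i) * ?t i + link_da (?a i) (?b i) * ?s i)"
  proof (rule sum.cong[OF refl])
    fix i assume "i \<in> {1..<d}"
    then have i: "1 \<le> i" "i < d" by auto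
    show "G0_grad d w $ i * ?t i + G0_grad d w $ (d + i - 1) * ?s i
        = link_db (?a i) (?b i) * ?t i + link_da (?a i) (?b i) * ?s i"
      unfolding G0_grad_index(2)[OF i] G0_grad_index(3)[OF i] ..
  qed
  finally have prod: "scalar_prod (G0_grad d w) h = - dPhi (w $ 0) * h $ 0
      + (\<Sum>i=1..<d. link_db (?a i) (?b i) * ?t i + link_da (?a i) (?b i) * ?s i)" .
  have "G0_stack d (w + h) = - Phi (w $ 0 + h $ 0) + (\<Sum>i=1..<d. link (?a i + ?s i) (?b i + ?t i))"
    using w h d by (subst G0_stack_link) (auto intro!: sum.cong)
  then have eq: "G0_stack d (w + h) - G0_stack d w - scalar_prod (G0_grad d w) h = - ?P + (\<Sum>i=1..<d. ?R i)"
    unfolding prod G0_stack_link[OF w d] by (simp add: sum.distrib sum_subtractf)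
  have "\<bar>G0_stack d (w + h) - G0_stack d w - scalar_prod (G0_grad d w) h\<bar>
      \<le> \<bar>?P\<bar> + (\<Sum>i=1..<d. \<bar>?R i\<bar>)"
    unfolding eq
    by (rule order_trans[OF abs_triangle_ineq]) (simp only: abs_minus_cancel add_le_cancel_left sum_abs)
  also have "\<dots> \<le> 4 * dbound\<^sup>2 * (h $ 0)\<^sup>2 + (\<Sum>i=1..<d. 4 * dbound\<^sup>2 * ((?t i)\<^sup>2 + (?s i)\<^sup>2))"
  proof (rule add_mono)
    have "\<bar>?P\<bar> \<le> dbound * (h $ 0)\<^sup>2"
      by (rule second_deriv_bound_taylor[OF DERIV_Phi DERIV_dPhi dbounds(6)])
    also have "\<dots> \<le> 4 * dbound\<^sup>2 * (h $ 0)\<^sup>2" by (intro mult_right_mono) (auto simp: dbound_def)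
    finally show "\<bar>?P\<bar> \<le> 4 * dbound\<^sup>2 * (h $ 0)\<^sup>2" .
    have "\<bar>?R i\<bar> \<le> 4 * dbound\<^sup>2 * ((?t i)\<^sup>2 + (?s i)\<^sup>2)" for i
      using link_taylor[of "?a i" "?s i" "?b i" "?t i"] by (simp add: add.commute)
    then show "(\<Sum>i=1..<d. \<bar>?R i\<bar>) \<le> (\<Sum>i=1..<d. 4 * dbound\<^sup>2 * ((?t i)\<^sup>2 + (?s i)\<^sup>2))"
      by (rule sum_mono)
  qed
  also have "\<dots> \<le> 4 * dbound\<^sup>2 * (\<Sum>m<2 * d. (h $ m)\<^sup>2)"
    unfolding sum_linked_pairs[OF d] by (simp add: distrib_left sum_distrib_left)
  finally show ?thesis using euclid_norm_sq[OF h] by simp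
qed

lemma G0_stack_has_gradient:
  assumes "w \<in> carrier_vec (2 * d)" "1 \<le> d"
  shows "has_gradient (2 * d) (G0_stack d) w (G0_grad d w)"
  using assms G0_stack_taylor by (intro has_gradient_quadratic[where C = "4 * dbound\<^sup>2"]) auto

lemma G0_grad_lipschitz:
  assumes w: "w \<in> carrier_vec (2 * d)" and z: "z \<in> carrier_vec (2 * d)" and d: "1 \<le> d"
  shows "euclid_norm (G0_grad d w - G0_grad d z) \<le> 4 * dbound\<^sup>2 * euclid_norm (w - z)"
proof -
  let ?u = "\<lambda>m. w $ m - z $ m"
  let ?g = "\<lambda>m. (G0_grad d w $ m - G0_grad d z $ m)\<^sup>2"
  have "(euclid_norm (G0_grad d w - G0_grad d z))\<^sup>2 = (\<Sum>m<2 * d. ?g m)"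
    by (subst euclid_norm_sq[of _ "2 * d"]) (auto simp: G0_grad_def)
  also have "\<dots> = ?g 0 + (\<Sum>i=1..<d. ?g i + ?g (d + i - 1)) + ?g (2 * d - 1)"
    by (rule sum_linked_pairs[OF d])
  also have "\<dots> \<le> 16 * dbound ^ 4 * (?u 0)\<^sup>2
      + (\<Sum>i=1..<d. 16 * dbound ^ 4 * ((?u i)\<^sup>2 + (?u (d + i - 1))\<^sup>2))
      + 16 * dbound ^ 4 * (?u (2 * d - 1))\<^sup>2"
  proof (rule add_mono[OF add_mono])
    have "\<bar>dPhi (w $ 0) - dPhi (z $ 0)\<bar> \<le> dbound * \<bar>w $ 0 - z $ 0\<bar>"
      by (rule deriv_bound_lipschitz[OF DERIV_dPhi dbounds(6)])
    then have "(dPhi (w $ 0) - dPhi (z $ 0))\<^sup>2 \<le> (dbound * \<bar>w $ 0 - z $ 0\<bar>)\<^sup>2"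
      by (metis power2_abs power_mono abs_ge_zero)
    also have "\<dots> = dbound\<^sup>2 * (?u 0)\<^sup>2" by (simp add: power_mult_distrib)
    also have "\<dots> \<le> 16 * dbound ^ 4 * (?u 0)\<^sup>2" by (intro mult_right_mono) (auto simp: dbound_def)
    finally show "?g 0 \<le> 16 * dbound ^ 4 * (?u 0)\<^sup>2"
      unfolding G0_grad_index(1)[OF d] by (simp add: power2_commute)
    show "(\<Sum>i=1..<d. ?g i + ?g (d + i - 1))
        \<le> (\<Sum>i=1..<d. 16 * dbound ^ 4 * ((?u i)\<^sup>2 + (?u (d + i - 1))\<^sup>2))"
    proof (rule sum_mono)
      fix i assume "i \<in> {1..<d}"
      then have i: "1 \<le> i" "i < d" by auto
      \<comment> \<open>Each of the two partial derivatives contributes 8, whence 16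
        \<open>dbound\<close>^4, the square of the claimed constant.\<close>
      show "?g i + ?g (d + i - 1) \<le> 16 * dbound ^ 4 * ((?u i)\<^sup>2 + (?u (d + i - 1))\<^sup>2)"
        unfolding G0_grad_index(2)[OF i] G0_grad_index(3)[OF i]
        using link_da_lipschitz[of "w $ (d + i - 1)" "w $ i" "z $ (d + i - 1)" "z $ i"]
          link_db_lipschitz[of "w $ (d + i - 1)" "w $ i" "z $ (d + i - 1)" "z $ i"]
        by argo
    qed
    show "?g (2 * d - 1) \<le> 16 * dbound ^ 4 * (?u (2 * d - 1))\<^sup>2"
      unfolding G0_grad_index(4)[OF d] by (simp add: dbound_def)
  qed
  also have "\<dots> \<le> 16 * dbound ^ 4 * (\<Sum>m<2 * d. (?u m)\<^sup>2)"
    unfolding sum_linked_pairs[OF d] by (simp only: distrib_left sum_distrib_left order_refl)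
  also have "\<dots> = (4 * dbound\<^sup>2 * euclid_norm (w - z))\<^sup>2"
    using euclid_norm_sq[of "w - z" "2 * d"] w z
    by (simp add: power_mult_distrib flip: power_mult)
  finally show ?thesis by (rule power2_le_imp_le) (simp add: dbound_def)
qed

text \<open>Turns smoothness with an arbitrary constant into a Lipschitz inequality for the explicit
  formula, the form in which it is rescaled on each pair of blocks.\<close>

lemma G0_smooth_iff:
  assumes "1 \<le> d"
  shows "G0_smooth d l \<longleftrightarrow> (\<forall>w\<in>carrier_vec (2 * d). \<forall>z\<in>carrier_vec (2 * d).
    euclid_norm (G0_grad d w - G0_grad d z) \<le> l * euclid_norm (w - z))"
proof -
  have "G0_stack d = (\<lambda>w. G0 d (vec_first w d) (vec_last w d))" by (auto simp: G0_stack_def)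
  moreover have "gradient (2 * d) (G0_stack d) w = G0_grad d w" if "w \<in> carrier_vec (2 * d)" for w
    using gradient_eq[OF G0_stack_has_gradient[OF that assms]] .
  ultimately show ?thesis
    using G0_stack_has_gradient[OF _ assms] unfolding G0_smooth_def lip_smooth_def by auto
qed

lemma G0_smooth_dbound: "1 \<le> d \<Longrightarrow> G0_smooth d (4 * dbound\<^sup>2)"
  using G0_grad_lipschitz by (simp add: G0_smooth_iff)

subsection \<open>The hard objective\<close>

text \<open>The point at which the i-th copy of \<open>G\<close> is evaluated. These pairs partition
  the 2 N blocks, so inner products, norms and the objective are all sums over them.\<close>

definition uv_pair :: "nat \<Rightarrow> nat \<Rightarrow> real vec \<Rightarrow> nat \<Rightarrow> real vec" where
  "uv_pair N d x i = block d x i @\<^sub>v block d x (N + i)"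

lemma uv_pair_carrier [simp]: "uv_pair N d x i \<in> carrier_vec (2 * d)"
  by (rule carrier_vecI) (simp add: uv_pair_def)

lemma dim_uv_pair [simp]: "dim_vec (uv_pair N d x i) = 2 * d"
  by (simp add: uv_pair_def)

lemma uv_pair_index [simp]:
  "q < d \<Longrightarrow> uv_pair N d x i $ q = x $ (i * d + q)"
  "q < d \<Longrightarrow> uv_pair N d x i $ (d + q) = x $ ((N + i) * d + q)"
  by (simp_all add: uv_pair_def)

lemma G0_stack_uv_pair: "G0_stack d (c \<cdot>\<^sub>v uv_pair N d x i) = G0 d (c \<cdot>\<^sub>v block d x i) (c \<cdot>\<^sub>v block d x (N + i))"
proof -
  have "vec_first (c \<cdot>\<^sub>v uv_pair N d x i) d = c \<cdot>\<^sub>v block d x i"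
    by (intro eq_vecI) (auto simp: vec_first_def uv_pair_def)
  moreover have "vec_last (c \<cdot>\<^sub>v uv_pair N d x i) d = c \<cdot>\<^sub>v block d x (N + i)"
    by (intro eq_vecI) (auto simp: vec_last_def uv_pair_def)
  ultimately show ?thesis by (simp add: G0_stack_def)
qed

lemma sum_uv_pairs:
  fixes F :: "nat \<Rightarrow> real"
  shows "(\<Sum>m<2 * N * d. F m) = (\<Sum>i<N. (\<Sum>q<d. F (i * d + q)) + (\<Sum>q<d. F ((N + i) * d + q)))"
proof -
  have "(\<Sum>m<2 * N * d. F m) = (\<Sum>b<2 * N. \<Sum>q<d. F (b * d + q))" by (rule sum_blocks)
  also have "\<dots> = (\<Sum>i<N. \<Sum>q<d. F (i * d + q)) + (\<Sum>i<N. \<Sum>q<d. F ((N + i) * d + q))"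
    using sum_blocks[of "\<lambda>b. \<Sum>q<d. F (b * d + q)" 2 N] by (simp add: numeral_2_eq_2)
  finally show ?thesis by (simp add: sum.distrib)
qed

lemma scalar_prod_uv_pairs:
  assumes "x \<in> carrier_vec (2 * N * d)" "y \<in> carrier_vec (2 * N * d)"
  shows "scalar_prod x y = (\<Sum>i<N. scalar_prod (uv_pair N d x i) (uv_pair N d y i))"
proof -
  have "scalar_prod x y = (\<Sum>m<2 * N * d. x $ m * y $ m)"
    using assms by (simp add: scalar_prod_def atLeast0LessThan)
  also have "\<dots> = (\<Sum>i<N. (\<Sum>q<d. x $ (i * d + q) * y $ (i * d + q))
      + (\<Sum>q<d. x $ ((N + i) * d + q) * y $ ((N + i) * d + q)))"
    by (rule sum_uv_pairs)
  also have "\<dots> = (\<Sum>i<N. scalar_prod (uv_pair N d x i) (uv_pair N d y i))"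
  proof (rule sum.cong[OF refl])
    fix i
    have "scalar_prod (uv_pair N d x i) (uv_pair N d y i)
        = (\<Sum>m<2 * d. uv_pair N d x i $ m * uv_pair N d y i $ m)"
      using uv_pair_carrier[of N d y i] by (simp only: scalar_prod_def atLeast0LessThan carrier_vecD)
    also have "\<dots> = (\<Sum>q<d. x $ (i * d + q) * y $ (i * d + q))
      + (\<Sum>q<d. x $ ((N + i) * d + q) * y $ ((N + i) * d + q))"
      using sum_blocks[of "\<lambda>m. uv_pair N d x i $ m * uv_pair N d y i $ m" 2 d]
      by (simp add: numeral_2_eq_2)
    finally show "(\<Sum>q<d. x $ (i * d + q) * y $ (i * d + q))
      + (\<Sum>q<d. x $ ((N + i) * d + q) * y $ ((N + i) * d + q))
      = scalar_prod (uv_pair N d x i) (uv_pair N d y i)" by simp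
  qed
  finally show ?thesis .
qed

lemma euclid_norm_sq_uv_pairs:
  assumes "x \<in> carrier_vec (2 * N * d)"
  shows "(euclid_norm x)\<^sup>2 = (\<Sum>i<N. (euclid_norm (uv_pair N d x i))\<^sup>2)"
  using scalar_prod_uv_pairs[OF assms assms] by (simp add: scalar_prod_self_euclid_norm)

lemma eq_vec_halvesI:
  fixes v w :: "real vec"
  assumes "v \<in> carrier_vec (2 * d)" "w \<in> carrier_vec (2 * d)"
    and "\<And>q. q < d \<Longrightarrow> v $ q = w $ q" "\<And>q. q < d \<Longrightarrow> v $ (d + q) = w $ (d + q)"
  shows "v = w"
proof (rule eq_vec_blocksI[OF assms(1,2)])
  show "v $ (b * d + q) = w $ (b * d + q)" if "b < 2" "q < d" for b q
    using that assms(3,4) by (auto simp: less_2_cases_iff)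
qed

lemma uv_pair_add:
  assumes "x \<in> carrier_vec (2 * N * d)" "y \<in> carrier_vec (2 * N * d)" "i < N"
  shows "uv_pair N d (x + y) i = uv_pair N d x i + uv_pair N d y i"
proof (rule eq_vec_halvesI)
  fix q assume q: "q < d"
  have "i * d + q < 2 * N * d" "(N + i) * d + q < 2 * N * d"
    using q assms(3) by (auto intro!: block_index_less)
  then show "uv_pair N d (x + y) i $ q = (uv_pair N d x i + uv_pair N d y i) $ q"
    "uv_pair N d (x + y) i $ (d + q) = (uv_pair N d x i + uv_pair N d y i) $ (d + q)"
    using q assms by simp_all
qed simp_all

lemma uv_pair_diff:
  assumes "x \<in> carrier_vec (2 * N * d)" "y \<in> carrier_vec (2 * N * d)" "i < N"
  shows "uv_pair N d (x - y) i = uv_pair N d x i - uv_pair N d y i"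
proof (rule eq_vec_halvesI)
  fix q assume q: "q < d"
  have "i * d + q < 2 * N * d" "(N + i) * d + q < 2 * N * d"
    using q assms(3) by (auto intro!: block_index_less)
  then show "uv_pair N d (x - y) i $ q = (uv_pair N d x i - uv_pair N d y i) $ q"
    "uv_pair N d (x - y) i $ (d + q) = (uv_pair N d x i - uv_pair N d y i) $ (d + q)"
    using q assms by simp_all
qed simp_all

lemma hard_obj_uv_pairs:
  "hard_obj N d l L \<alpha> x = (\<Sum>i<N. L * \<alpha>\<^sup>2 / l * G0_stack d ((1 / \<alpha>) \<cdot>\<^sub>v uv_pair N d x i))"
  by (simp add: hard_obj_def G_def G0_stack_uv_pair)

text \<open>The chain rule for the inner scaling 1 / \<alpha> consumes one power of \<alpha>, hence
  L \<alpha> / l instead of L \<alpha>\<open>\<^sup>2\<close> / l.\<close>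

definition hard_grad :: "nat \<Rightarrow> nat \<Rightarrow> real \<Rightarrow> real \<Rightarrow> real \<Rightarrow> real vec \<Rightarrow> real vec" where
  "hard_grad N d l L \<alpha> x = vec (2 * N * d) (\<lambda>m.
     if m div d < N
     then L * \<alpha> / l * G0_grad d ((1 / \<alpha>) \<cdot>\<^sub>v uv_pair N d x (m div d)) $ (m mod d)
     else L * \<alpha> / l * G0_grad d ((1 / \<alpha>) \<cdot>\<^sub>v uv_pair N d x (m div d - N)) $ (d + m mod d))"

lemma hard_grad_carrier [simp]: "hard_grad N d l L \<alpha> x \<in> carrier_vec (2 * N * d)"
  by (simp add: hard_grad_def)

lemma dim_hard_grad [simp]: "dim_vec (hard_grad N d l L \<alpha> x) = 2 * N * d"
  by (simp add: hard_grad_def)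

lemma hard_grad_index:
  assumes "i < N" "q < d"
  shows "hard_grad N d l L \<alpha> x $ (i * d + q)
      = L * \<alpha> / l * G0_grad d ((1 / \<alpha>) \<cdot>\<^sub>v uv_pair N d x i) $ q"
    and "hard_grad N d l L \<alpha> x $ ((N + i) * d + q)
      = L * \<alpha> / l * G0_grad d ((1 / \<alpha>) \<cdot>\<^sub>v uv_pair N d x i) $ (d + q)"
proof -
  have "i * d + q < 2 * N * d" "(N + i) * d + q < 2 * N * d"
    using assms by (auto intro!: block_index_less)
  moreover have "(b * d + q) div d = b" "(b * d + q) mod d = q" for b
    using assms(2) by auto
  ultimately show "hard_grad N d l L \<alpha> x $ (i * d + q)
      = L * \<alpha> / l * G0_grad d ((1 / \<alpha>) \<cdot>\<^sub>v uv_pair N d x i) $ q"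
    "hard_grad N d l L \<alpha> x $ ((N + i) * d + q)
      = L * \<alpha> / l * G0_grad d ((1 / \<alpha>) \<cdot>\<^sub>v uv_pair N d x i) $ (d + q)"
    using assms unfolding hard_grad_def by (simp_all only: index_vec) simp_all
qed

lemma uv_pair_hard_grad:
  assumes "i < N"
  shows "uv_pair N d (hard_grad N d l L \<alpha> x) i
    = (L * \<alpha> / l) \<cdot>\<^sub>v G0_grad d ((1 / \<alpha>) \<cdot>\<^sub>v uv_pair N d x i)"
  using assms by (intro eq_vec_halvesI[where d = d]) (simp_all add: hard_grad_index)

lemma hard_obj_has_gradient:
  assumes x: "x \<in> carrier_vec (2 * N * d)" and d: "1 \<le> d" and \<alpha>: "\<alpha> \<noteq> 0"
  shows "has_gradient (2 * N * d) (hard_obj N d l L \<alpha>) x (hard_grad N d l L \<alpha> x)"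
proof (rule has_gradient_quadratic[OF x hard_grad_carrier])
  fix h :: "real vec" assume h: "h \<in> carrier_vec (2 * N * d)"
  let ?w = "\<lambda>i. (1 / \<alpha>) \<cdot>\<^sub>v uv_pair N d x i" and ?h = "\<lambda>i. (1 / \<alpha>) \<cdot>\<^sub>v uv_pair N d h i"
  let ?R = "\<lambda>i. L * \<alpha>\<^sup>2 / l *
    (G0_stack d (?w i + ?h i) - G0_stack d (?w i) - scalar_prod (G0_grad d (?w i)) (?h i))"
  let ?C = "\<bar>L / l\<bar> * (4 * dbound\<^sup>2)"
  have "scalar_prod (hard_grad N d l L \<alpha> x) h
      = (\<Sum>i<N. scalar_prod ((L * \<alpha> / l) \<cdot>\<^sub>v G0_grad d (?w i)) (uv_pair N d h i))"
    unfolding scalar_prod_uv_pairs[OF hard_grad_carrier h] by (simp add: uv_pair_hard_grad)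
  also have "\<dots> = (\<Sum>i<N. L * \<alpha>\<^sup>2 / l * scalar_prod (G0_grad d (?w i)) (?h i))"
  proof (rule sum.cong[OF refl])
    fix i
    show "scalar_prod ((L * \<alpha> / l) \<cdot>\<^sub>v G0_grad d (?w i)) (uv_pair N d h i)
        = L * \<alpha>\<^sup>2 / l * scalar_prod (G0_grad d (?w i)) (?h i)"
      using \<alpha> by (simp add: power2_eq_square)
  qed
  finally have prod: "scalar_prod (hard_grad N d l L \<alpha> x) h
    = (\<Sum>i<N. L * \<alpha>\<^sup>2 / l * scalar_prod (G0_grad d (?w i)) (?h i))" .
  have "hard_obj N d l L \<alpha> (x + h) = (\<Sum>i<N. L * \<alpha>\<^sup>2 / l * G0_stack d (?w i + ?h i))"
    unfolding hard_obj_uv_pairs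
    by (rule sum.cong[OF refl])
      (simp add: uv_pair_add[OF x h] smult_add_distrib_vec[OF uv_pair_carrier uv_pair_carrier])
  then have "hard_obj N d l L \<alpha> (x + h) - hard_obj N d l L \<alpha> x
      - scalar_prod (hard_grad N d l L \<alpha> x) h = (\<Sum>i<N. ?R i)"
    unfolding prod hard_obj_uv_pairs[of N d l L \<alpha> x]
    by (simp only: right_diff_distrib sum_subtractf)
  then have "\<bar>hard_obj N d l L \<alpha> (x + h) - hard_obj N d l L \<alpha> x
      - scalar_prod (hard_grad N d l L \<alpha> x) h\<bar> \<le> (\<Sum>i<N. \<bar>?R i\<bar>)"
    by (simp only: sum_abs)
  also have "\<dots> \<le> (\<Sum>i<N. ?C * (euclid_norm (uv_pair N d h i))\<^sup>2)"
  proof (rule sum_mono)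
    fix i
    have "\<bar>?R i\<bar> \<le> \<bar>L * \<alpha>\<^sup>2 / l\<bar> * (4 * dbound\<^sup>2 * (euclid_norm (?h i))\<^sup>2)"
      unfolding abs_mult[of "L * \<alpha>\<^sup>2 / l"]
      by (intro mult_left_mono G0_stack_taylor) (use d in auto)
    also have "\<dots> = ?C * (euclid_norm (uv_pair N d h i))\<^sup>2"
      using \<alpha> by (simp add: euclid_norm_smult abs_mult power_mult_distrib power_divide)
    finally show "\<bar>?R i\<bar> \<le> ?C * (euclid_norm (uv_pair N d h i))\<^sup>2" .
  qed
  also have "\<dots> = ?C * (euclid_norm h)\<^sup>2"
    unfolding euclid_norm_sq_uv_pairs[OF h] by (simp only: sum_distrib_left)
  finally show "\<bar>hard_obj N d l L \<alpha> (x + h) - hard_obj N d l L \<alpha> x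
      - scalar_prod (hard_grad N d l L \<alpha> x) h\<bar> \<le> ?C * (euclid_norm h)\<^sup>2" .
qed

lemma smult_minus_distrib_vec:
  fixes v w :: "real vec"
  assumes "v \<in> carrier_vec n" "w \<in> carrier_vec n"
  shows "c \<cdot>\<^sub>v (v - w) = c \<cdot>\<^sub>v v - c \<cdot>\<^sub>v w"
  using assms by (intro eq_vecI) (auto simp: right_diff_distrib)

text \<open>The normalisation of \<open>G\<close> is made for this: L \<alpha> / l from the outside,
  l from \<open>G0\<close> and 1 / \<alpha> from the argument multiply to L, and distinct pairs do
  not interact.\<close>

lemma hard_grad_lipschitz:
  assumes smooth: "G0_smooth d l" and l: "l > 0" and d: "1 \<le> d" and \<alpha>: "\<alpha> > 0" and L: "L > 0"
    and x: "x \<in> carrier_vec (2 * N * d)" and y: "y \<in> carrier_vec (2 * N * d)"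
  shows "euclid_norm (hard_grad N d l L \<alpha> x - hard_grad N d l L \<alpha> y) \<le> L * euclid_norm (x - y)"
proof -
  let ?g = "hard_grad N d l L \<alpha>"
  have "(euclid_norm (?g x - ?g y))\<^sup>2 = (\<Sum>i<N. (euclid_norm (uv_pair N d (?g x) i - uv_pair N d (?g y) i))\<^sup>2)"
    by (subst euclid_norm_sq_uv_pairs[of _ N d]) (simp_all add: uv_pair_diff minus_carrier_vec)
  also have "\<dots> \<le> (\<Sum>i<N. (L * euclid_norm (uv_pair N d x i - uv_pair N d y i))\<^sup>2)"
  proof (rule sum_mono)
    fix i assume "i \<in> {..<N}"
    then have i: "i < N" by simp
    let ?w = "(1 / \<alpha>) \<cdot>\<^sub>v uv_pair N d x i" and ?z = "(1 / \<alpha>) \<cdot>\<^sub>v uv_pair N d y i"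
    have "uv_pair N d (?g x) i - uv_pair N d (?g y) i
        = (L * \<alpha> / l) \<cdot>\<^sub>v (G0_grad d ?w - G0_grad d ?z)"
      unfolding uv_pair_hard_grad[OF i]
      by (rule smult_minus_distrib_vec[symmetric]) (rule G0_grad_carrier)+
    then have "euclid_norm (uv_pair N d (?g x) i - uv_pair N d (?g y) i)
        = L * \<alpha> / l * euclid_norm (G0_grad d ?w - G0_grad d ?z)"
      using l \<alpha> L by (simp add: euclid_norm_smult)
    also have "\<dots> \<le> L * \<alpha> / l * (l * euclid_norm (?w - ?z))"
      using smooth l \<alpha> L by (intro mult_left_mono) (simp_all add: G0_smooth_iff[OF d])
    also have "?w - ?z = (1 / \<alpha>) \<cdot>\<^sub>v (uv_pair N d x i - uv_pair N d y i)"
      by (rule smult_minus_distrib_vec[symmetric]) (rule uv_pair_carrier)+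
    also have "L * \<alpha> / l * (l * euclid_norm \<dots>) = L * euclid_norm (uv_pair N d x i - uv_pair N d y i)"
      using l \<alpha> by (simp add: euclid_norm_smult)
    finally show "(euclid_norm (uv_pair N d (?g x) i - uv_pair N d (?g y) i))\<^sup>2
        \<le> (L * euclid_norm (uv_pair N d x i - uv_pair N d y i))\<^sup>2"
      by (rule power_mono) simp
  qed
  also have "\<dots> = (L * euclid_norm (x - y))\<^sup>2"
    using euclid_norm_sq_uv_pairs[of "x - y" N d] x y
    by (simp add: power_mult_distrib uv_pair_diff sum_distrib_left)
  finally show ?thesis by (rule power2_le_imp_le) (use L in simp)
qed

lemma gradient_hard_obj:
  assumes "x \<in> carrier_vec (2 * N * d)" "1 \<le> d" "\<alpha> \<noteq> 0"
  shows "gradient (2 * N * d) (hard_obj N d l L \<alpha>) x = hard_grad N d l L \<alpha> x"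
  by (rule gradient_eq[OF hard_obj_has_gradient[OF assms]])

lemma lip_smooth_hard_obj:
  assumes "G0_smooth d l" "l > 0" "1 \<le> d" "\<alpha> > 0" "L > 0"
  shows "lip_smooth (2 * N * d) L (hard_obj N d l L \<alpha>)"
  unfolding lip_smooth_def
proof (intro conjI ballI)
  have \<alpha>: "\<alpha> \<noteq> 0" using assms(4) by simp
  fix x :: "real vec" assume x: "x \<in> carrier_vec (2 * N * d)"
  show "\<exists>g. has_gradient (2 * N * d) (hard_obj N d l L \<alpha>) x g"
    using hard_obj_has_gradient[OF x assms(3) \<alpha>] by blast
  fix y :: "real vec" assume y: "y \<in> carrier_vec (2 * N * d)"
  show "euclid_norm (gradient (2 * N * d) (hard_obj N d l L \<alpha>) x
      - gradient (2 * N * d) (hard_obj N d l L \<alpha>) y) \<le> L * euclid_norm (x - y)"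
    unfolding gradient_hard_obj[OF x assms(3) \<alpha>] gradient_hard_obj[OF y assms(3) \<alpha>]
    by (rule hard_grad_lipschitz[OF assms x y])
qed

subsection \<open>Conditioning of the consensus matrix\<close>

lemma consensus_mat_carrier [simp]: "consensus_mat N d \<in> carrier_mat ((2 * N - 1) * d) (2 * N * d)"
  by (simp add: consensus_mat_def)

lemma dim_consensus_mat [simp]:
  "dim_row (consensus_mat N d) = (2 * N - 1) * d" "dim_col (consensus_mat N d) = 2 * N * d"
  by (simp_all add: consensus_mat_def)

lemma consensus_mat_mult_index:
  assumes "x \<in> carrier_vec (2 * N * d)" "i < 2 * N - 1" "q < d"
  shows "(consensus_mat N d *\<^sub>v x) $ (i * d + q) = x $ (i * d + q) - x $ ((i + 1) * d + q)"
  using arg_cong[OF consensus_mat_block[OF assms(1,2)], of "\<lambda>v. v $ q"] assms(3)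
  by simp

text \<open>The dual variables of the edges of the path, extended by zero at both ends; edge \<open>c\<close> joins
  the blocks \<open>c - 1\<close> and \<open>c\<close>.\<close>

definition edge_val :: "nat \<Rightarrow> nat \<Rightarrow> real vec \<Rightarrow> nat \<Rightarrow> nat \<Rightarrow> real" where
  "edge_val N d w q c = (if 1 \<le> c \<and> c < 2 * N then w $ ((c - 1) * d + q) else 0)"

text \<open>Column m has at most two nonzero entries, 1 in row m and -1 in row m - d. The zero
  extension in \<open>edge_val\<close> lets one formula cover the end blocks, where one of them is
  missing.\<close>

lemma transpose_consensus_mat_mult_index:
  assumes w: "w \<in> carrier_vec ((2 * N - 1) * d)" and b: "b < 2 * N" and q: "q < d"
  shows "(transpose_mat (consensus_mat N d) *\<^sub>v w) $ (b * d + q)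
    = edge_val N d w q (b + 1) - edge_val N d w q b"
proof -
  let ?n = "(2 * N - 1) * d" and ?m = "b * d + q"
  have m: "?m < 2 * N * d" using b q by (rule block_index_less)
  have nd: "?n + d = 2 * N * d" using b by (cases N) (auto simp: algebra_simps)
  have "(transpose_mat (consensus_mat N d) *\<^sub>v w) $ ?m
      = (\<Sum>r<?n. (if ?m = r then 1 else if ?m = r + d then - 1 else 0) * w $ r)"
    using m w by (auto simp: consensus_mat_def scalar_prod_def atLeast0LessThan intro!: sum.cong)
  also have "\<dots> = (\<Sum>r<?n. (if r = ?m then w $ r else 0) - (if r + d = ?m then w $ r else 0))"
    using q by (intro sum.cong) auto
  also have "\<dots> = (\<Sum>r<?n. if r = ?m then w $ r else 0) - (\<Sum>r<?n. if r + d = ?m then w $ r else 0)"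
    by (rule sum_subtractf)
  also have "(\<Sum>r<?n. if r = ?m then w $ r else 0) = edge_val N d w q (b + 1)"
  proof (cases "b < 2 * N - 1")
    case True
    then have "?m < ?n" using q by (rule block_index_less)
    then show ?thesis using True by (simp add: edge_val_def)
  next
    case False
    then have "b = 2 * N - 1" using b by simp
    then show ?thesis by (simp add: edge_val_def)
  qed
  also have "(\<Sum>r<?n. if r + d = ?m then w $ r else 0) = edge_val N d w q b"
  proof (cases b)
    case 0
    then show ?thesis using q by (auto simp: edge_val_def intro!: sum.neutral)
  next
    case (Suc c)
    have "r + d = ?m \<longleftrightarrow> r = c * d + q" for r using Suc by auto
    moreover have "c * d + q < ?n" using m nd Suc by simp
    ultimately show ?thesis using Suc b by (simp add: edge_val_def)
  qed
  finally show ?thesis .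
qed

lemma gram_consensus_mat_index:
  assumes w: "w \<in> carrier_vec ((2 * N - 1) * d)" and i: "i < 2 * N - 1" and q: "q < d"
  shows "((consensus_mat N d * transpose_mat (consensus_mat N d)) *\<^sub>v w) $ (i * d + q)
    = 2 * edge_val N d w q (i + 1) - edge_val N d w q i - edge_val N d w q (i + 2)"
proof -
  let ?A = "consensus_mat N d"
  have AT: "transpose_mat ?A \<in> carrier_mat (2 * N * d) ((2 * N - 1) * d)"
    by (intro carrier_matI) simp_all
  have "(?A * transpose_mat ?A) *\<^sub>v w = ?A *\<^sub>v (transpose_mat ?A *\<^sub>v w)"
    by (rule assoc_mult_mat_vec[OF consensus_mat_carrier AT w])
  moreover have "transpose_mat ?A *\<^sub>v w \<in> carrier_vec (2 * N * d)" using AT w by simp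
  ultimately show ?thesis
    using consensus_mat_mult_index[of "transpose_mat ?A *\<^sub>v w" N d i q] i q
      transpose_consensus_mat_mult_index[OF w _ q, of i]
      transpose_consensus_mat_mult_index[OF w _ q, of "i + 1"]
    by simp
qed

text \<open>The parabola \<open>c (2 N - c)\<close> is a supersolution of the discrete Dirichlet problem, so comparing
  an eigenvector with it at the point of largest ratio bounds the eigenvalue from below.\<close>

lemma path_eigenvalue_ge:
  fixes y :: "nat \<Rightarrow> real"
  assumes "y 0 = 0" "y (2 * N) = 0" and nz: "\<exists>c. 1 \<le> c \<and> c < 2 * N \<and> y c \<noteq> 0"
    and ev: "\<And>c. 1 \<le> c \<Longrightarrow> c < 2 * N \<Longrightarrow> 2 * y c - y (c - 1) - y (c + 1) = ev * y c"
  shows "2 / (real N)\<^sup>2 \<le> ev"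
proof -
  define phi where "phi c = real c * (2 * real N - real c)" for c :: nat
  let ?I = "{1..<2 * N}"
  define r where "r = Max ((\<lambda>c. \<bar>y c\<bar> / phi c) ` ?I)"
  obtain c0 where c0: "1 \<le> c0" "c0 < 2 * N" "y c0 \<noteq> 0" using nz by blast
  have phi_pos: "phi c > 0" if "1 \<le> c" "c < 2 * N" for c
    using that by (simp add: phi_def)
  have r_ge: "\<bar>y c\<bar> / phi c \<le> r" if "1 \<le> c" "c < 2 * N" for c
    unfolding r_def using that by (intro Max_ge) auto
  have "r \<in> (\<lambda>c. \<bar>y c\<bar> / phi c) ` ?I"
    unfolding r_def by (intro Max_in) (use c0 in auto)
  then obtain c where c: "1 \<le> c" "c < 2 * N" "r = \<bar>y c\<bar> / phi c" by auto
  have r: "r > 0"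
  proof -
    have "0 < \<bar>y c0\<bar> / phi c0" using c0 phi_pos[of c0] by simp
    then show ?thesis using r_ge[of c0] c0 by linarith
  qed
  have yc: "\<bar>y c\<bar> = r * phi c" using c phi_pos[of c] by simp
  have le: "\<bar>y b\<bar> \<le> r * phi b" if "b \<le> 2 * N" for b
  proof (cases "1 \<le> b \<and> b < 2 * N")
    case True
    then show ?thesis using r_ge[of b] phi_pos[of b] by (simp add: field_simps)
  next
    case False
    then have "b = 0 \<or> b = 2 * N" using that by auto
    then show ?thesis using assms(1,2) by (auto simp: phi_def)
  qed
  have le1: "\<bar>y (c - 1)\<bar> \<le> r * phi (c - 1)" using c by (intro le) simp
  have le2: "\<bar>y (c + 1)\<bar> \<le> r * phi (c + 1)" using c by (intro le) simp
  \<comment> \<open>The eigenvalue equation is multiplied by the sign of y at c; then the neighbours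
    enter only through their moduli, which r * \<open>phi\<close> dominates with equality at
    c.\<close>
  have "2 * \<bar>y c\<bar> - \<bar>y (c - 1)\<bar> - \<bar>y (c + 1)\<bar> \<le> ev * \<bar>y c\<bar>"
    using ev[OF c(1,2)] by (cases "y c \<ge> 0") auto
  then have "r * (2 * phi c - phi (c - 1) - phi (c + 1)) \<le> ev * (r * phi c)"
    using le1 le2 unfolding yc by (simp add: algebra_simps)
  moreover have "2 * phi c - phi (c - 1) - phi (c + 1) = 2"
    using c(1) by (simp add: phi_def of_nat_diff algebra_simps)
  ultimately have "r * 2 \<le> r * (ev * phi c)" by (simp add: mult_ac)
  then have ev_phi: "2 \<le> ev * phi c" using r by simp
  then have "0 < ev * phi c" by linarith
  then have "0 < ev" using phi_pos[OF c(1,2)] by (simp add: zero_less_mult_iff)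
  \<comment> \<open>The parabola has its maximum N\<open>\<^sup>2\<close> in the middle of the
    path.\<close>
  moreover have "phi c \<le> (real N)\<^sup>2"
    using zero_le_power2[of "real N - real c"] by (simp add: phi_def power2_diff power2_eq_square algebra_simps)
  ultimately have "ev * phi c \<le> ev * (real N)\<^sup>2" by (simp add: mult_left_mono)
  then have "2 \<le> ev * (real N)\<^sup>2" using ev_phi by linarith
  moreover have "N > 0" using c by simp
  ultimately show ?thesis by (simp add: field_simps)
qed

text \<open>The Gram matrix acts on every coordinate q within the blocks separately. A q at which
  the eigenvector is nonzero yields an eigenvector of the scalar path for the same
  eigenvalue.\<close>

lemma gram_eigenvalue_ge:
  assumes "eigenvalue (consensus_mat N d * transpose_mat (consensus_mat N d)) ev"
  shows "2 / (real N)\<^sup>2 \<le> ev"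
proof -
  let ?B = "consensus_mat N d * transpose_mat (consensus_mat N d)" and ?n = "(2 * N - 1) * d"
  obtain w where w: "w \<in> carrier_vec ?n" "w \<noteq> 0\<^sub>v ?n" "?B *\<^sub>v w = ev \<cdot>\<^sub>v w"
    using assms by (auto simp: eigenvalue_def eigenvector_def)
  obtain b q where bq: "b < 2 * N - 1" "q < d" "w $ (b * d + q) \<noteq> 0"
  proof (rule ccontr)
    assume "\<not> thesis"
    then have "w = 0\<^sub>v ?n"
      using w(1) that by (intro eq_vec_blocksI[of _ "2 * N - 1" d]) (auto simp: block_index_less)
    with w(2) show False by simp
  qed
  show ?thesis
  proof (rule path_eigenvalue_ge[of "edge_val N d w q"])
    show "\<exists>c. 1 \<le> c \<and> c < 2 * N \<and> edge_val N d w q c \<noteq> 0"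
      using bq by (intro exI[of _ "b + 1"]) (auto simp: edge_val_def)
    fix c assume c: "1 \<le> c" "c < 2 * N"
    then have i: "c - 1 < 2 * N - 1" by simp
    have "(ev \<cdot>\<^sub>v w) $ ((c - 1) * d + q) = ev * edge_val N d w q c"
      using c w(1) block_index_less[OF i bq(2)] by (simp add: edge_val_def)
    then show "2 * edge_val N d w q c - edge_val N d w q (c - 1) - edge_val N d w q (c + 1)
        = ev * edge_val N d w q c"
      using gram_consensus_mat_index[OF w(1) i bq(2)] w(3) c by simp
  qed (simp_all add: edge_val_def)
qed

text \<open>\<open>Min\<close> of the singular values is only meaningful because this set is nonempty: the vector
  \<open>1, 0, -1, 0, \<dots>\<close> on the edges is an eigenvector for the eigenvalue 2.\<close>

lemma gram_eigenvalue_2: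
  assumes N: "1 \<le> N" and d: "1 \<le> d"
  shows "eigenvalue (consensus_mat N d * transpose_mat (consensus_mat N d)) 2"
proof -
  let ?B = "consensus_mat N d * transpose_mat (consensus_mat N d)" and ?n = "(2 * N - 1) * d"
  \<comment> \<open>A closed form of the pattern 1, 0, -1, 0 that also vanishes at both ends 0 and 2
    N. Since s (b + 2) = - s b, the two neighbours cancel in the second difference.\<close>
  define s where "s c = sin (real c * (pi / 2))" for c :: nat
  define w where "w = vec ?n (\<lambda>m. s (m div d + 1))"
  have w: "w \<in> carrier_vec ?n" by (simp add: w_def)
  have "(b * d + q) div d = b" if "q < d" for b q using that by simp
  then have w_index: "w $ (b * d + q) = s (b + 1)" if "b < 2 * N - 1" "q < d" for b q
    using that block_index_less[OF that] by (simp add: w_def)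
  have "s (2 * N) = 0" using sin_npi[of N] by (simp add: s_def mult.commute)
  then have edge: "edge_val N d w q c = s c" if "c \<le> 2 * N" "q < d" for c q
    using that by (cases "c = 0"; cases "c = 2 * N") (auto simp: edge_val_def w_index s_def)
  have "?B *\<^sub>v w = 2 \<cdot>\<^sub>v w"
  proof (rule eq_vec_blocksI[of _ "2 * N - 1" d])
    fix b q assume b: "b < 2 * N - 1" and q: "q < d"
    have "real (b + 2) * (pi / 2) = real b * (pi / 2) + pi" by (simp add: algebra_simps)
    then have "s (b + 2) = - s b" by (simp only: s_def sin_periodic_pi)
    then show "(?B *\<^sub>v w) $ (b * d + q) = (2 \<cdot>\<^sub>v w) $ (b * d + q)"
      using b q w block_index_less[OF b q]
      by (simp only: gram_consensus_mat_index[OF w b q]) (simp add: edge w_index)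
  qed (use w in \<open>auto intro!: carrier_vecI\<close>)
  moreover have "w \<noteq> 0\<^sub>v ?n"
  proof
    assume "w = 0\<^sub>v ?n"
    moreover have "w $ (0 * d + 0) = s (0 + 1)" using N d by (intro w_index) auto
    moreover have "0 < ?n" using N d by simp
    ultimately show False by (simp add: s_def)
  qed
  ultimately show ?thesis using w by (auto simp: eigenvalue_def eigenvector_def)
qed

lemma singular_values_consensus_mat:
  assumes "1 \<le> N" "1 \<le> d"
  shows "finite (singular_values (consensus_mat N d))"
    and "sqrt 2 \<in> singular_values (consensus_mat N d)"
    and "s \<in> singular_values (consensus_mat N d) \<Longrightarrow> sqrt 2 / real N \<le> s"
proof -
  let ?B = "consensus_mat N d * transpose_mat (consensus_mat N d)" and ?n = "(2 * N - 1) * d"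
  have sv: "singular_values (consensus_mat N d) = {s. 0 \<le> s \<and> eigenvalue ?B (s\<^sup>2)}"
    by (simp add: singular_values_def diff_mult_distrib)
  have B: "?B \<in> carrier_mat ?n ?n" by (intro carrier_matI) simp_all
  have "char_poly ?B \<noteq> 0" using degree_monic_char_poly[OF B] by auto
  then have "finite {e. poly (char_poly ?B) e = 0}" by (rule poly_roots_finite)
  then have "finite (sqrt ` {e. eigenvalue ?B e})" by (simp add: eigenvalue_root_char_poly[OF B])
  moreover have "singular_values (consensus_mat N d) \<subseteq> sqrt ` {e. eigenvalue ?B e}"
  proof
    fix s assume "s \<in> singular_values (consensus_mat N d)"
    then show "s \<in> sqrt ` {e. eigenvalue ?B e}"
      unfolding sv by (intro image_eqI[of _ _ "s\<^sup>2"]) auto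
  qed
  ultimately show "finite (singular_values (consensus_mat N d))" by (rule finite_subset[rotated])
  show "sqrt 2 \<in> singular_values (consensus_mat N d)"
    using gram_eigenvalue_2[OF assms] by (simp add: sv)
  assume "s \<in> singular_values (consensus_mat N d)"
  then have s: "0 \<le> s" "2 / (real N)\<^sup>2 \<le> s\<^sup>2" using gram_eigenvalue_ge by (auto simp: sv)
  then have "(sqrt 2 / real N)\<^sup>2 \<le> s\<^sup>2" by (simp add: power_divide)
  then show "sqrt 2 / real N \<le> s" using s(1) by (rule power2_le_imp_le)
qed

text \<open>The right-hand side is 2 N - 1 times the lower bound on the singular values, so that the
  quotient is exactly 2 N - 1. For N >= 2 the crude norm bound 2 is below it, each block being an
  endpoint of at most two differences. For N = 1 there is a single difference and the bound improves
  to sqrt 2, which is just what is needed.\<close>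

lemma operator_norm_consensus_mat:
  assumes N: "1 \<le> N"
  shows "operator_norm (consensus_mat N d) \<le> (2 * real N - 1) * (sqrt 2 / real N)"
  unfolding operator_norm_def
proof (rule cSUP_least)
  show "{x \<in> carrier_vec (dim_col (consensus_mat N d)). euclid_norm x \<le> 1} \<noteq> {}"
    using zero_carrier_vec[of "2 * N * d"] by (auto intro!: exI[of _ "0\<^sub>v (2 * N * d)"])
  fix x assume "x \<in> {x \<in> carrier_vec (dim_col (consensus_mat N d)). euclid_norm x \<le> 1}"
  then have x: "x \<in> carrier_vec (2 * N * d)" and x1: "euclid_norm x \<le> 1" by auto
  define f where "f b = (\<Sum>q<d. (x $ (b * d + q))\<^sup>2)" for b
  have f0: "0 \<le> f b" for b by (simp add: f_def sum_nonneg)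
  have normx: "(euclid_norm x)\<^sup>2 = (\<Sum>b<2 * N. f b)"
    unfolding f_def by (rule euclid_norm_sq_blocks[OF x])
  have "(euclid_norm (consensus_mat N d *\<^sub>v x))\<^sup>2
      = (\<Sum>i<2 * N - 1. \<Sum>q<d. ((consensus_mat N d *\<^sub>v x) $ (i * d + q))\<^sup>2)"
    using x by (intro euclid_norm_sq_blocks mult_mat_vec_carrier) auto
  also have "\<dots> \<le> (\<Sum>i<2 * N - 1. \<Sum>q<d. 2 * ((x $ (i * d + q))\<^sup>2 + (x $ ((i + 1) * d + q))\<^sup>2))"
  proof (intro sum_mono)
    fix i q assume "i \<in> {..<2 * N - 1}" "q \<in> {..<d}"
    moreover have "(a - b)\<^sup>2 \<le> 2 * (a\<^sup>2 + b\<^sup>2)" for a b :: real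
      using zero_le_power2[of "a + b"] by (simp add: power2_sum power2_diff)
    ultimately show "((consensus_mat N d *\<^sub>v x) $ (i * d + q))\<^sup>2
        \<le> 2 * ((x $ (i * d + q))\<^sup>2 + (x $ ((i + 1) * d + q))\<^sup>2)"
      using consensus_mat_mult_index[OF x] by simp
  qed
  also have "\<dots> = 2 * (\<Sum>i<2 * N - 1. f i + f (i + 1))"
    by (simp add: f_def sum_distrib_left sum.distrib)
  finally have bound: "(euclid_norm (consensus_mat N d *\<^sub>v x))\<^sup>2 \<le> 2 * (\<Sum>i<2 * N - 1. f i + f (i + 1))" .
  have sums: "(\<Sum>b<2 * N. f b) = (\<Sum>i<2 * N - 1. f i) + f (2 * N - 1)"
    "(\<Sum>b<2 * N. f b) = f 0 + (\<Sum>i<2 * N - 1. f (i + 1))"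
  proof -
    obtain M where M: "2 * N = Suc M" using N by (cases "2 * N") auto
    show "(\<Sum>b<2 * N. f b) = (\<Sum>i<2 * N - 1. f i) + f (2 * N - 1)" unfolding M by simp
    show "(\<Sum>b<2 * N. f b) = f 0 + (\<Sum>i<2 * N - 1. f (i + 1))"
      unfolding M by (simp add: sum.lessThan_Suc_shift del: sum.lessThan_Suc)
  qed
  have norm1: "(euclid_norm x)\<^sup>2 \<le> 1" using x1 by (simp add: power_le_one)
  have "(euclid_norm (consensus_mat N d *\<^sub>v x))\<^sup>2 \<le> ((2 * real N - 1) * (sqrt 2 / real N))\<^sup>2"
  proof (cases "N = 1")
    case True
    then have "2 * (\<Sum>i<2 * N - 1. f i + f (i + 1)) = 2 * (\<Sum>b<2 * N. f b)"
      by (simp add: numeral_2_eq_2)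
    then show ?thesis using bound norm1 normx True by simp
  next
    case False
    then have N2: "real N \<ge> 2" using N by linarith
    have "4 * (real N)\<^sup>2 \<le> 2 * (2 * real N - 1)\<^sup>2"
      using mult_right_mono[OF N2, of "real N"] by (simp add: power2_eq_square algebra_simps)
    then have "4 \<le> (2 * real N - 1)\<^sup>2 * (2 / (real N)\<^sup>2)"
      using N2 by (simp add: pos_le_divide_eq mult.commute)
    then have N_bound: "4 \<le> ((2 * real N - 1) * (sqrt 2 / real N))\<^sup>2"
      unfolding power_mult_distrib power_divide by simp
    have "(\<Sum>i<2 * N - 1. f i + f (i + 1)) \<le> 2 * (\<Sum>b<2 * N. f b)"
      using sums f0[of 0] f0[of "2 * N - 1"] by (simp add: sum.distrib)
    then have "(euclid_norm (consensus_mat N d *\<^sub>v x))\<^sup>2 \<le> 4" using bound norm1 normx by linarith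
    then show ?thesis using N_bound by (rule order_trans)
  qed
  then show "euclid_norm (consensus_mat N d *\<^sub>v x) \<le> (2 * real N - 1) * (sqrt 2 / real N)"
    by (rule power2_le_imp_le) (use N in simp)
qed

lemma condition_number_consensus_mat:
  assumes N: "1 \<le> N" and d: "1 \<le> d"
  shows "condition_number (consensus_mat N d) \<le> ereal (2 * real N - 1)"
proof -
  define s where "s = Min (singular_values (consensus_mat N d))"
  note sv = singular_values_consensus_mat[OF N d]
  have "s \<in> singular_values (consensus_mat N d)"
    unfolding s_def using sv(1,2) by (intro Min_in) auto
  then have s: "sqrt 2 / real N \<le> s" by (rule sv(3))
  have "0 < sqrt 2 / real N" using N by simp
  then have pos: "0 < s" using s by linarith
  have "operator_norm (consensus_mat N d) \<le> (2 * real N - 1) * (sqrt 2 / real N)"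
    by (rule operator_norm_consensus_mat[OF N])
  also have "\<dots> \<le> (2 * real N - 1) * s" using s N by (intro mult_left_mono) auto
  finally have "operator_norm (consensus_mat N d) / s \<le> 2 * real N - 1"
    using pos by (simp add: divide_le_eq)
  then show ?thesis using pos by (simp add: condition_number_def flip: s_def)
qed

subsection \<open>Zero chain and function gap\<close>

lemma link_db_0 [simp]: "link_db 0 b = 0" by (simp add: link_db_def)

lemma link_da_0 [simp]: "link_da 0 b = 0" by (simp add: link_da_def)

lemma G0_grad_second_half:
  assumes "q < d" "q + 1 < d \<Longrightarrow> w $ (d + q) = 0"
  shows "G0_grad d w $ (d + q) = 0"
proof (cases "q + 1 < d")
  case True
  then show ?thesis using G0_grad_index(3)[of "q + 1" d w] assms(2) by simp
next
  case False
  then have "d + q = 2 * d - 1" using assms(1) by simp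
  then show ?thesis using G0_grad_index(4)[of d w] assms(1) by simp
qed

text \<open>The derivative in \<open>u\<^sub>q\<close> carries factors \<open>Psi\<close> at plus
  and minus \<open>v\<^sub>q\<^sub>-\<^sub>1\<close>, the derivative in \<open>v\<^sub>q\<close>
  factors \<open>dPsi\<close> at plus and minus \<open>v\<^sub>q\<close>, and both functions vanish
  at 0. Only coordinate 0 of the blocks below N has a source of its own, hence 1 <= q there.\<close>

lemma hard_grad_index_zero:
  assumes b: "b < 2 * N" and q: "q < d"
    and first: "b < N \<Longrightarrow> 1 \<le> q \<and> x $ ((N + b) * d + (q - 1)) = 0"
    and second: "N \<le> b \<Longrightarrow> x $ (b * d + q) = 0"
  shows "hard_grad N d l L \<alpha> x $ (b * d + q) = 0"
proof (cases "b < N")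
  case True
  let ?w = "(1 / \<alpha>) \<cdot>\<^sub>v uv_pair N d x b"
  obtain r where r: "q = Suc r" using first[OF True] by (cases q) auto
  have "?w $ (d + r) = 0" using first[OF True] q r by simp
  then have "G0_grad d ?w $ q = 0" using G0_grad_index(2)[of q d ?w] q r by auto
  then show ?thesis unfolding hard_grad_index(1)[OF True q] by simp
next
  case False
  define i where "i = b - N"
  have i: "i < N" "b = N + i" using b False by (auto simp: i_def)
  have "G0_grad d ((1 / \<alpha>) \<cdot>\<^sub>v uv_pair N d x i) $ (d + q) = 0"
    using second q i by (intro G0_grad_second_half) auto
  then show ?thesis unfolding i(2) hard_grad_index(2)[OF i(1) q] by simp
qed

text \<open>A new coordinate \<open>q + 1\<close> is produced only by a gradient step passing from block \<open>N + i\<close> to block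
  \<open>i\<close>, while the matrix moves information by one block per step; so each further coordinate costs
  \<open>N + 1\<close> steps and block \<open>b\<close> sees it with delay \<open>b\<close>.\<close>

lemma span_set_zero_chain:
  assumes d: "1 \<le> d" and \<alpha>: "\<alpha> \<noteq> 0"
    and iter: "linear_span_iterates (hard_obj N d l L \<alpha>) (consensus_mat N d) (0\<^sub>v ((2 * N - 1) * d)) x"
    and y: "y \<in> span_set (hard_obj N d l L \<alpha>) (consensus_mat N d) (0\<^sub>v ((2 * N - 1) * d)) x t"
  shows "y \<in> carrier_vec (2 * N * d) \<and>
    (\<forall>b<2 * N. \<forall>q<d. t + N < q * (N + 1) + b + 1 \<longrightarrow> y $ (b * d + q) = 0)"
  using y
proof (induction t arbitrary: y rule: less_induct)
  case (less t)
  let ?A = "consensus_mat N d" and ?b = "0\<^sub>v ((2 * N - 1) * d)"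
  let ?S = "span_set (hard_obj N d l L \<alpha>) ?A ?b x"
  have x0: "x 0 = 0\<^sub>v (2 * N * d)" and xS: "\<And>i. x i \<in> ?S i"
    using iter by (auto simp: linear_span_iterates_def)
  show ?case
  proof (cases t)
    case 0
    have "y \<in> vec_span (2 * N * d) {0\<^sub>v (2 * N * d)}" using less.prems 0 x0 by simp
    then show ?thesis
      using vec_span_index_zero[of "{0\<^sub>v (2 * N * d)}" "2 * N * d" y] block_index_less[of _ "2 * N" _ d]
      by auto
  next
    case (Suc k)
    define gens where "gens = (\<Union>i\<in>{..k}. {x i} \<union> gradient (2 * N * d) (hard_obj N d l L \<alpha>) ` ?S i \<union>
        (\<lambda>y. transpose_mat ?A *\<^sub>v (?A *\<^sub>v y - ?b)) ` ?S i)"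
    have y: "y \<in> vec_span (2 * N * d) gens" using less.prems Suc by (simp add: gens_def)
    have gen: "g \<in> carrier_vec (2 * N * d) \<and>
      (\<forall>b<2 * N. \<forall>q<d. t + N < q * (N + 1) + b + 1 \<longrightarrow> g $ (b * d + q) = 0)" if g: "g \<in> gens" for g
    proof -
      obtain i z where i: "i \<le> k" and z: "z \<in> ?S i"
        and g: "g = z \<or> g = gradient (2 * N * d) (hard_obj N d l L \<alpha>) z
          \<or> g = transpose_mat ?A *\<^sub>v (?A *\<^sub>v z - ?b)"
        using g xS unfolding gens_def by blast
      have it: "i < t" using i Suc by simp
      have zc: "z \<in> carrier_vec (2 * N * d)"
        and z0: "\<And>b q. b < 2 * N \<Longrightarrow> q < d \<Longrightarrow> i + N < q * (N + 1) + b + 1 \<Longrightarrow> z $ (b * d + q) = 0"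
        using less.IH[OF it z] by auto
      consider "g = z" | "g = hard_grad N d l L \<alpha> z" | "g = transpose_mat ?A *\<^sub>v (?A *\<^sub>v z - ?b)"
        using g gradient_hard_obj[OF zc d \<alpha>] by metis
      then show ?thesis
      proof cases
        case 1
        then show ?thesis using zc z0 it by auto
      next
        case 2
        have "hard_grad N d l L \<alpha> z $ (b * d + q) = 0"
          if bq: "b < 2 * N" "q < d" "t + N < q * (N + 1) + b + 1" for b q
        proof (rule hard_grad_index_zero[OF bq(1,2)])
          assume b: "b < N"
          \<comment> \<open>For q = 0 the hypothesis would read t + N < b + 1, impossible for b <
            N.\<close>
          have "q \<noteq> 0" using bq(3) b by (cases q) auto
          then obtain r where r: "q = Suc r" by (cases q) auto
          \<comment> \<open>The delay q (N + 1) + b drops by exactly one on passing from coordinate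
            r + 1 of block b to coordinate r of block N + b; the step from i to t pays for
            it.\<close>
          have "z $ ((N + b) * d + r) = 0" using b bq r it by (intro z0) auto
          then show "1 \<le> q \<and> z $ ((N + b) * d + (q - 1)) = 0" using r by simp
        next
          show "z $ (b * d + q) = 0" using bq it by (intro z0) auto
        qed
        then show ?thesis using 2 by simp
      next
        case 3
        let ?w = "?A *\<^sub>v z - ?b"
        have w: "?w \<in> carrier_vec ((2 * N - 1) * d)" by (intro carrier_vecI) simp
        \<comment> \<open>Edge c sees the blocks c - 1 and c, so the delay drops by at most one here
          too.\<close>
        have edge0: "edge_val N d ?w q c = 0"
          if c: "q < d" "t + N < q * (N + 1) + c + 1" for q c
        proof (cases "1 \<le> c \<and> c < 2 * N")
          case True
          then have c1: "c - 1 < 2 * N - 1" by auto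
          have "z $ ((c - 1) * d + q) = 0" "z $ (c * d + q) = 0"
            using True c it by (auto intro!: z0)
          then have "(?A *\<^sub>v z) $ ((c - 1) * d + q) = 0"
            using consensus_mat_mult_index[OF zc c1 c(1)] True by simp
          then show ?thesis
            using True block_index_less[OF c1 c(1)] by (simp add: edge_val_def)
        qed (auto simp: edge_val_def)
        have "(transpose_mat ?A *\<^sub>v ?w) $ (b * d + q) = 0"
          if bq: "b < 2 * N" "q < d" "t + N < q * (N + 1) + b + 1" for b q
          unfolding transpose_consensus_mat_mult_index[OF w bq(1,2)] using edge0 bq by simp
        moreover have "transpose_mat ?A *\<^sub>v ?w \<in> carrier_vec (2 * N * d)"
          by (intro carrier_vecI) simp
        ultimately show ?thesis using 3 by simp
      qed
    qed
    have "gens \<subseteq> carrier_vec (2 * N * d)" using gen by auto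
    note span = vec_span_index_zero[OF this y]
    show ?thesis
    proof (intro conjI allI impI)
      show "y \<in> carrier_vec (2 * N * d)" by (rule span(1))
      fix b q assume bq: "b < 2 * N" "q < d" "t + N < q * (N + 1) + b + 1"
      show "y $ (b * d + q) = 0"
        by (rule span(2)[OF block_index_less[OF bq(1,2)]]) (use gen bq in blast)
    qed
  qed
qed

section \<open>Bounds on the objective and membership in the problem class\<close>

lemma G0_stack_ge:
  assumes "w \<in> carrier_vec (2 * d)" and d: "1 \<le> d"
  shows "- 12 * real d \<le> G0_stack d w"
proof -
  have link: "- 12 \<le> link a b" for a b
  proof -
    have "Psi a * Phi b \<le> exp 1 * Phi b" by (intro mult_right_mono Psi_le_exp1 Phi_nonneg)
    moreover have "0 \<le> Psi (- a) * Phi (- b)" by (simp add: Psi_nonneg Phi_nonneg)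
    ultimately show ?thesis using exp1_Phi_le_12[of b] by (simp add: link_def)
  qed
  have "1 * Phi (w $ 0) \<le> exp 1 * Phi (w $ 0)" using Phi_nonneg by (intro mult_right_mono) auto
  then have "Phi (w $ 0) \<le> 12" using exp1_Phi_le_12[of "w $ 0"] by linarith
  \<comment> \<open>The d - 1 links and the initial term each cost at most 12.\<close>
  moreover have "(\<Sum>i=1..<d. - 12) \<le> (\<Sum>i=1..<d. link (w $ (d + i - 1)) (w $ i))"
    by (intro sum_mono link)
  ultimately show ?thesis unfolding G0_stack_link[OF assms] using d by (simp add: of_nat_diff)
qed

lemma hard_obj_ge:
  assumes "l > 0" "L > 0" "1 \<le> d"
  shows "- (L * \<alpha>\<^sup>2 / l * (12 * real N * real d)) \<le> hard_obj N d l L \<alpha> x"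
proof -
  have "(\<Sum>i<N. L * \<alpha>\<^sup>2 / l * (- 12 * real d)) \<le> hard_obj N d l L \<alpha> x"
    unfolding hard_obj_uv_pairs
    using assms by (intro sum_mono mult_left_mono G0_stack_ge) auto
  then show ?thesis by (simp add: mult_ac)
qed

text \<open>At the origin all links vanish because \<open>Psi\<close> does, and each copy of
  \<open>G0\<close> retains only - \<open>Phi\<close> 0.\<close>

lemma hard_obj_0_le:
  assumes "l > 0" "L > 0" "1 \<le> d"
  shows "hard_obj N d l L \<alpha> (0\<^sub>v (2 * N * d)) \<le> 0"
  unfolding hard_obj_uv_pairs
proof (intro sum_nonpos mult_nonneg_nonpos)
  fix i assume "i \<in> {..<N}"
  then have i: "i < N" by simp
  let ?w = "(1 / \<alpha>) \<cdot>\<^sub>v uv_pair N d (0\<^sub>v (2 * N * d)) i"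
  have w: "?w $ m = 0" if "m < 2 * d" for m
  proof (cases "m < d")
    case True
    then show ?thesis using block_index_less[of i "2 * N" m d] i by simp
  next
    case False
    then have "m - d < d" "m = d + (m - d)" using that by auto
    then show ?thesis
      using block_index_less[of "N + i" "2 * N" "m - d" d] i uv_pair_index(2)[of "m - d" d N "0\<^sub>v (2 * N * d)" i]
      by simp
  qed
  have "(\<Sum>j=1..<d. link (?w $ (d + j - 1)) (?w $ j)) = 0"
  proof (intro sum.neutral ballI)
    fix j assume "j \<in> {1..<d}"
    then have "?w $ (d + j - 1) = 0" by (intro w) (simp, linarith)
    then show "link (?w $ (d + j - 1)) (?w $ j) = 0" by (simp add: link_def)
  qed
  then show "G0_stack d ?w \<le> 0"
    using assms(3) Phi_nonneg by (subst G0_stack_link) simp_all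
qed (use assms in simp)

lemma hard_instance_in_F_NC:
  assumes smooth: "G0_smooth d l" and l: "l > 0" and L: "L > 0" and \<alpha>: "\<alpha> > 0"
    and d: "1 \<le> d" and N: "1 \<le> N"
    and gap: "L * \<alpha>\<^sup>2 / l * (12 * real N * real d) \<le> \<Delta>" and \<kappa>: "2 * real N - 1 \<le> \<kappa>"
  shows "(hard_obj N d l L \<alpha>, set_indicator {0\<^sub>v ((2 * N - 1) * d)}, consensus_mat N d,
    0\<^sub>v ((2 * N - 1) * d), 0\<^sub>v (2 * N * d)) \<in> F_NC L \<Delta> \<kappa>"
proof -
  let ?f = "hard_obj N d l L \<alpha>" and ?m = "(2 * N - 1) * d" and ?n = "2 * N * d"
  let ?h = "set_indicator {0\<^sub>v ?m}" and ?A = "consensus_mat N d"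
  have proper: "proper_fun ?m ?h"
    by (auto simp: proper_fun_def set_indicator_def intro!: bexI[of _ "0\<^sub>v ?m"])
  have closed: "closed_fun ?m ?h"
    unfolding closed_fun_def
  proof (intro allI impI)
    fix Y T y t
    assume *: "(\<forall>i::nat. Y i \<in> carrier_vec ?m \<and> ?h (Y i) \<le> ereal (T i)) \<and> y \<in> carrier_vec ?m \<and>
        (\<lambda>i. euclid_norm (Y i - y)) \<longlonglongrightarrow> 0 \<and> T \<longlonglongrightarrow> t"
    have Y: "Y i = 0\<^sub>v ?m" "0 \<le> T i" for i
      using *[THEN conjunct1, rule_format, of i] by (auto simp: set_indicator_def split: if_splits)
    have y: "y \<in> carrier_vec ?m" and T: "T \<longlonglongrightarrow> t" using * by auto
    have "(\<lambda>i::nat. euclid_norm (0\<^sub>v ?m - y)) \<longlonglongrightarrow> 0" using * unfolding Y(1) by blast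
    then have "euclid_norm (0\<^sub>v ?m - y) = 0" by (simp add: LIMSEQ_const_iff)
    then have "euclid_norm y = 0"
      using euclid_norm_minus_commute[OF zero_carrier_vec y] y by simp
    then have "y = 0\<^sub>v ?m" using euclid_norm_eq_0_iff[OF y] by simp
    moreover have "0 \<le> t" using LIMSEQ_le_const[OF T] Y by auto
    ultimately show "?h y \<le> ereal t" by (simp add: set_indicator_def)
  qed
  have convex: "convex_fun ?m ?h"
    unfolding convex_fun_def
  proof (intro ballI allI impI)
    fix y z :: "real vec" and t :: real
    assume yz: "y \<in> carrier_vec ?m" "z \<in> carrier_vec ?m" and t: "0 < t \<and> t < 1"
    show "?h (t \<cdot>\<^sub>v y + (1 - t) \<cdot>\<^sub>v z) \<le> ereal t * ?h y + ereal (1 - t) * ?h z"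
    proof (cases "y = 0\<^sub>v ?m \<and> z = 0\<^sub>v ?m")
      case True
      then have "t \<cdot>\<^sub>v y + (1 - t) \<cdot>\<^sub>v z = 0\<^sub>v ?m" by (intro eq_vecI) auto
      then show ?thesis using True by (simp add: set_indicator_def)
    next
      case False
      then have top: "ereal t * ?h y + ereal (1 - t) * ?h z = \<infinity>"
        using t by (auto simp: set_indicator_def)
      show ?thesis unfolding top by (rule ereal_less_eq(1))
    qed
  qed
  have "?A *\<^sub>v 0\<^sub>v ?n - 0\<^sub>v ?m = 0\<^sub>v ?m"
    by (intro eq_vecI) (auto simp: scalar_prod_def)
  then have obj0: "composite_obj ?f ?h ?A (0\<^sub>v ?m) (0\<^sub>v ?n) = ereal (?f (0\<^sub>v ?n))"
    by (simp add: composite_obj_def set_indicator_def)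
  \<comment> \<open>The indicator is nonnegative, so the lower bound of the smooth part over the
    whole space bounds the constrained infimum.\<close>
  have "ereal (- \<Delta>) \<le> (INF x\<in>carrier_vec ?n. composite_obj ?f ?h ?A (0\<^sub>v ?m) x)"
  proof (rule INF_greatest)
    fix x
    have "- \<Delta> \<le> ?f x" using hard_obj_ge[OF l L d, of \<alpha> N x] gap by linarith
    then have "ereal (- \<Delta>) + 0 \<le> ereal (?f x) + ?h (?A *\<^sub>v x - 0\<^sub>v ?m)"
      by (intro add_mono) (auto simp: set_indicator_def)
    then show "ereal (- \<Delta>) \<le> composite_obj ?f ?h ?A (0\<^sub>v ?m) x" by (simp add: composite_obj_def)
  qed
  then have "composite_obj ?f ?h ?A (0\<^sub>v ?m) (0\<^sub>v ?n)
      - (INF x\<in>carrier_vec ?n. composite_obj ?f ?h ?A (0\<^sub>v ?m) x) \<le> ereal 0 - ereal (- \<Delta>)"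
    using hard_obj_0_le[OF l L d, of N \<alpha>] unfolding obj0 by (intro ereal_minus_mono) simp_all
  moreover have "condition_number ?A \<le> ereal \<kappa>"
    using condition_number_consensus_mat[OF N d] \<kappa> by (meson ereal_less_eq(3) order_trans)
  ultimately show ?thesis
    unfolding F_NC_def
    using proper closed convex lip_smooth_hard_obj[OF smooth l d \<alpha> L, of N] obj0
    by simp
qed

subsection \<open>Projection and stationarity\<close>

text \<open>Deviations from the mean sum to zero, so the mixed term drops out.\<close>

lemma sum_squares_about_mean:
  fixes f :: "nat \<Rightarrow> real"
  assumes "n > 0" and \<mu>: "\<mu> = (\<Sum>b<n. f b) / real n"
  shows "(\<Sum>b<n. (f b - c)\<^sup>2) = (\<Sum>b<n. (f b - \<mu>)\<^sup>2) + real n * (\<mu> - c)\<^sup>2"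
proof -
  have "(\<Sum>b<n. f b - \<mu>) = 0" using assms by (simp add: sum_subtractf)
  moreover have "(f b - c)\<^sup>2 = (f b - \<mu>)\<^sup>2 + 2 * (\<mu> - c) * (f b - \<mu>) + (\<mu> - c)\<^sup>2" for b
    by (simp add: power2_eq_square algebra_simps)
  then have "(\<Sum>b<n. (f b - c)\<^sup>2)
      = (\<Sum>b<n. (f b - \<mu>)\<^sup>2) + 2 * (\<mu> - c) * (\<Sum>b<n. f b - \<mu>) + real n * (\<mu> - c)\<^sup>2"
    by (simp add: sum.distrib sum_distrib_left)
  ultimately show ?thesis by simp
qed

definition block_mean :: "nat \<Rightarrow> nat \<Rightarrow> real vec \<Rightarrow> nat \<Rightarrow> real" where
  "block_mean n d x q = (\<Sum>b<n. x $ (b * d + q)) / real n"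

definition consensus_vec :: "nat \<Rightarrow> nat \<Rightarrow> (nat \<Rightarrow> real) \<Rightarrow> real vec" where
  "consensus_vec n d u = vec (n * d) (\<lambda>m. u (m mod d))"

lemma consensus_vec_carrier [simp]: "consensus_vec n d u \<in> carrier_vec (n * d)"
  by (simp add: consensus_vec_def)

lemma dim_consensus_vec [simp]: "dim_vec (consensus_vec n d u) = n * d"
  by (simp add: consensus_vec_def)

lemma consensus_vec_index [simp]:
  "b < n \<Longrightarrow> q < d \<Longrightarrow> consensus_vec n d u $ (b * d + q) = u q"
  by (simp add: consensus_vec_def block_index_less)

lemma consensus_vec_in_set: "consensus_vec (2 * N) d u \<in> consensus_set N d"
proof -
  have "block d (consensus_vec (2 * N) d u) i = vec d u" if "i < 2 * N" for i
    using that by (intro eq_vecI) auto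
  then show ?thesis unfolding consensus_set_def by simp
qed

lemma consensus_setD:
  assumes "z \<in> consensus_set N d"
  shows "z \<in> carrier_vec (2 * N * d)" and "i < 2 * N \<Longrightarrow> block d z i = block d z 0"
proof -
  have z: "z \<in> carrier_vec (2 * N * d) \<and> (\<forall>i<2 * N. block d z i = block d z 0)"
    by (rule CollectD[OF assms[unfolded consensus_set_def]])
  show "z \<in> carrier_vec (2 * N * d)" by (rule conjunct1[OF z])
  assume "i < 2 * N"
  then show "block d z i = block d z 0" by (rule conjunct2[OF z, rule_format])
qed

lemma consensus_set_eq:
  assumes "z \<in> consensus_set N d"
  shows "z = consensus_vec (2 * N) d (\<lambda>q. z $ q)"
proof (rule eq_vec_blocksI[OF consensus_setD(1)[OF assms] consensus_vec_carrier])
  fix b q assume b: "b < 2 * N" and q: "q < d"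
  have "block d z b $ q = block d z 0 $ q" unfolding consensus_setD(2)[OF assms b] ..
  then show "z $ (b * d + q) = consensus_vec (2 * N) d (\<lambda>q. z $ q) $ (b * d + q)"
    using b q by simp
qed

text \<open>The Pythagorean theorem for the consensus space, with block averaging as the orthogonal
  projection. It serves three times: to compute \<open>euclid_proj\<close>, to split the
  stationarity measure, and to see that averaging does not increase norms.\<close>

lemma euclid_norm_consensus_decomp:
  assumes n: "n > 0" and y: "y \<in> carrier_vec (n * d)"
  shows "(euclid_norm (y - consensus_vec n d u))\<^sup>2
    = (euclid_norm (y - consensus_vec n d (block_mean n d y)))\<^sup>2
      + real n * (\<Sum>q<d. (block_mean n d y q - u q)\<^sup>2)"
proof -
  have norm: "(euclid_norm (y - consensus_vec n d v))\<^sup>2 = (\<Sum>q<d. \<Sum>b<n. (y $ (b * d + q) - v q)\<^sup>2)" for v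
  proof -
    have "(euclid_norm (y - consensus_vec n d v))\<^sup>2
        = (\<Sum>b<n. \<Sum>q<d. ((y - consensus_vec n d v) $ (b * d + q))\<^sup>2)"
      using y by (intro euclid_norm_sq_blocks) simp
    also have "\<dots> = (\<Sum>b<n. \<Sum>q<d. (y $ (b * d + q) - v q)\<^sup>2)"
    proof (rule sum.cong[OF refl], rule sum.cong[OF refl])
      fix b q assume "b \<in> {..<n}" "q \<in> {..<d}"
      then have "b < n" "q < d" by auto
      then show "((y - consensus_vec n d v) $ (b * d + q))\<^sup>2 = (y $ (b * d + q) - v q)\<^sup>2"
        using y block_index_less[of b n q d] by simp
    qed
    also have "\<dots> = (\<Sum>q<d. \<Sum>b<n. (y $ (b * d + q) - v q)\<^sup>2)" by (rule sum.swap)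
    finally show ?thesis .
  qed
  have "(\<Sum>b<n. (y $ (b * d + q) - u q)\<^sup>2) = (\<Sum>b<n. (y $ (b * d + q) - block_mean n d y q)\<^sup>2)
      + real n * (block_mean n d y q - u q)\<^sup>2" for q
    by (rule sum_squares_about_mean[OF n block_mean_def])
  then show ?thesis unfolding norm by (simp add: sum.distrib sum_distrib_left)
qed

lemma euclid_proj_consensus_set:
  assumes N: "1 \<le> N" and y: "y \<in> carrier_vec (2 * N * d)"
  shows "euclid_proj (consensus_set N d) y = consensus_vec (2 * N) d (block_mean (2 * N) d y)"
proof -
  let ?p = "consensus_vec (2 * N) d (block_mean (2 * N) d y)"
  have n: "2 * N > 0" using N by simp
  have decomp: "(euclid_norm (y - z))\<^sup>2 = (euclid_norm (y - ?p))\<^sup>2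
      + real (2 * N) * (\<Sum>q<d. (block_mean (2 * N) d y q - z $ q)\<^sup>2)"
    if "z \<in> consensus_set N d" for z
    by (subst consensus_set_eq[OF that]) (rule euclid_norm_consensus_decomp[OF n y])
  have le: "euclid_norm (y - ?p) \<le> euclid_norm (y - z)" if "z \<in> consensus_set N d" for z
    by (rule power2_le_imp_le) (auto simp: decomp[OF that] sum_nonneg)
  show ?thesis
    unfolding euclid_proj_def
  proof (rule the_equality)
    show "?p \<in> consensus_set N d \<and> (\<forall>q\<in>consensus_set N d. euclid_norm (y - ?p) \<le> euclid_norm (y - q))"
      using le consensus_vec_in_set by blast
    \<comment> \<open>\<open>euclid_proj\<close> is a definite description, so uniqueness is due as
      well: by the decomposition, any minimiser has zero excess and hence agrees with the block
      means.\<close>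
    fix p assume p: "p \<in> consensus_set N d \<and> (\<forall>q\<in>consensus_set N d. euclid_norm (y - p) \<le> euclid_norm (y - q))"
    then have pX: "p \<in> consensus_set N d" by blast
    have "euclid_norm (y - p) \<le> euclid_norm (y - ?p)" using p consensus_vec_in_set by blast
    then have "(euclid_norm (y - p))\<^sup>2 \<le> (euclid_norm (y - ?p))\<^sup>2" by (rule power_mono) simp
    then have "real (2 * N) * (\<Sum>q<d. (block_mean (2 * N) d y q - p $ q)\<^sup>2) \<le> 0"
      unfolding decomp[OF pX] by linarith
    then have "(\<Sum>q<d. (block_mean (2 * N) d y q - p $ q)\<^sup>2) \<le> 0" using N by (simp add: mult_le_0_iff)
    then have "(\<Sum>q<d. (block_mean (2 * N) d y q - p $ q)\<^sup>2) = 0"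
      by (intro antisym sum_nonneg) auto
    then have "\<forall>q\<in>{..<d}. (block_mean (2 * N) d y q - p $ q)\<^sup>2 = 0"
      by (subst (asm) sum_nonneg_eq_0_iff) auto
    then have eq: "p $ q = block_mean (2 * N) d y q" if "q < d" for q using that by simp
    show "p = ?p"
    proof (rule eq_vec_blocksI[OF consensus_setD(1)[OF pX] consensus_vec_carrier])
      fix b q assume "b < 2 * N" "q < d"
      then show "p $ (b * d + q) = ?p $ (b * d + q)"
        using consensus_set_eq[OF pX] eq consensus_vec_index by metis
    qed
  qed
qed

section \<open>Large gradients at points whose last coordinate vanishes\<close>

text \<open>At the first coordinate with \<open>\<bar>u\<^sub>j\<bar> < 1\<close> its predecessor has modulus at least 1, and all
  contributions to the derivative in direction \<open>j\<close> have the same sign.\<close>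

lemma G0_grad_diagonal_large:
  assumes w: "\<And>q. q < d \<Longrightarrow> w $ q = u q" "\<And>q. q < d \<Longrightarrow> w $ (d + q) = u q"
    and d: "1 \<le> d" and last: "u (d - 1) = 0"
  shows "\<exists>j<d. G0_grad d w $ j + G0_grad d w $ (d + j) \<le> - 1"
proof -
  define j where "j = (LEAST q. \<bar>u q\<bar> < 1)"
  have "\<bar>u (d - 1)\<bar> < 1" using last by simp
  then have j: "\<bar>u j\<bar> < 1" "j \<le> d - 1"
    unfolding j_def by (auto intro: LeastI Least_le)
  then have jd: "j < d" using d by simp
  have "G0_grad d w $ (d + j) \<le> 0"
  proof (cases "j + 1 < d")
    case True
    have "link_da a b \<le> 0" for a b
      unfolding link_da_def neg_le_0_iff_le
      by (intro add_nonneg_nonneg mult_nonneg_nonneg dPsi_nonneg Phi_nonneg)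
    then show ?thesis using G0_grad_index(3)[of "j + 1" d w] True by simp
  next
    case False
    then have "d + j = 2 * d - 1" using jd by simp
    then show ?thesis using G0_grad_index(4)[OF d, of w] by simp
  qed
  moreover have "G0_grad d w $ j \<le> - 1"
  proof (cases j)
    \<comment> \<open>Coordinate 0 has no predecessor; its slope comes from the initial term -
      \<open>Psi\<close> 1 * \<open>Phi\<close>, with \<open>Psi\<close> 1 = 1.\<close>
    case 0
    then show ?thesis using G0_grad_index(1)[OF d, of w] dPhi_ge_1[of "u 0"] j(1) w(1)[of 0] d by simp
  next
    case (Suc i)
    have "\<not> \<bar>u i\<bar> < 1" using not_less_Least[of i "\<lambda>q. \<bar>u q\<bar> < 1"] Suc by (simp add: j_def)
    then have "1 \<le> u i \<or> 1 \<le> - u i" by auto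
    then have "1 \<le> Psi (- u i) + Psi (u i)"
      using Psi_ge_1[of "u i"] Psi_ge_1[of "- u i"] Psi_nonneg[of "u i"] Psi_nonneg[of "- u i"] by auto
    then have "1 * 1 \<le> (Psi (- u i) + Psi (u i)) * dPhi (u j)"
      using dPhi_ge_1[of "u j"] j(1) by (intro mult_mono) auto
    moreover have "G0_grad d w $ j = - ((Psi (- u i) + Psi (u i)) * dPhi (u j))"
      using G0_grad_index(2)[of j d w] jd Suc w by (simp add: link_db_def algebra_simps)
    ultimately show ?thesis by simp
  qed
  ultimately show ?thesis using jd by (intro exI[of _ j]) auto
qed

text \<open>At a consensus point all N pairs see the same argument, and each adds its u part and its
  v part. Averaging these N equal sums over 2 N blocks produces the factor 1/2.\<close>

lemma hard_grad_consensus_large: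
  assumes N: "1 \<le> N" and d: "1 \<le> d" and \<alpha>: "\<alpha> > 0" and l: "l > 0" and L: "L > 0"
    and last: "u (d - 1) = 0"
  shows "\<exists>j<d. L * \<alpha> / (2 * l) \<le>
    \<bar>block_mean (2 * N) d (hard_grad N d l L \<alpha> (consensus_vec (2 * N) d u)) j\<bar>"
proof -
  let ?x = "consensus_vec (2 * N) d u"
  let ?w = "\<lambda>i. (1 / \<alpha>) \<cdot>\<^sub>v uv_pair N d ?x i"
  have w: "?w i $ q = u q / \<alpha>" "?w i $ (d + q) = u q / \<alpha>" if "i < N" "q < d" for i q
    using that by simp_all
  have same: "?w i = ?w 0" if "i < N" for i
  proof (rule eq_vec_halvesI[of _ d])
    fix q assume q: "q < d"
    have 0: "0 < N" using N by simp
    show "?w i $ q = ?w 0 $ q" unfolding w(1)[OF that q] w(1)[OF 0 q] ..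
    show "?w i $ (d + q) = ?w 0 $ (d + q)" unfolding w(2)[OF that q] w(2)[OF 0 q] ..
  qed simp_all
  have "\<exists>j<d. G0_grad d (?w 0) $ j + G0_grad d (?w 0) $ (d + j) \<le> - 1"
    by (rule G0_grad_diagonal_large[of d _ "\<lambda>q. u q / \<alpha>"]) (use w[of 0] N d last in auto)
  then obtain j where j: "j < d" "G0_grad d (?w 0) $ j + G0_grad d (?w 0) $ (d + j) \<le> - 1" by blast
  let ?s = "G0_grad d (?w 0) $ j + G0_grad d (?w 0) $ (d + j)"
  let ?g = "hard_grad N d l L \<alpha> ?x"
  have "(\<Sum>b<2 * N. ?g $ (b * d + j)) = (\<Sum>i<N. ?g $ (i * d + j) + ?g $ ((N + i) * d + j))"
    using sum_blocks[of "\<lambda>b. ?g $ (b * d + j)" 2 N] by (simp add: numeral_2_eq_2 sum.distrib)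
  also have "\<dots> = (\<Sum>i<N. L * \<alpha> / l * ?s)"
  proof (rule sum.cong[OF refl])
    fix i assume "i \<in> {..<N}"
    then have i: "i < N" by simp
    show "?g $ (i * d + j) + ?g $ ((N + i) * d + j) = L * \<alpha> / l * ?s"
      unfolding hard_grad_index[OF i j(1)] same[OF i] by (simp add: distrib_left)
  qed
  finally have "block_mean (2 * N) d ?g j = L * \<alpha> / (2 * l) * ?s"
    using N by (simp add: block_mean_def)
  moreover have "L * \<alpha> / (2 * l) * 1 \<le> L * \<alpha> / (2 * l) * \<bar>?s\<bar>"
    using j(2) l L \<alpha> by (intro mult_left_mono) auto
  ultimately show ?thesis using j(1) l L \<alpha> by (intro exI[of _ j]) (simp add: abs_mult)
qed

text \<open>The squared distance from x to the projected gradient step is the squared distance R to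
  consensus plus 2 N times the squared entries of the averaged gradient step. If R is small, the
  averaged gradient at x is close to that at the projection c of x, which is large; otherwise R
  itself gives the bound.\<close>

lemma SubOpt_NC_hard_obj_ge:
  assumes smooth: "G0_smooth d l" and N: "1 \<le> N" and d: "1 \<le> d" and \<alpha>: "\<alpha> > 0" and l: "l > 0" and L: "L > 0"
    and x: "x \<in> carrier_vec (2 * N * d)"
    and last: "\<And>b. b < 2 * N \<Longrightarrow> x $ (b * d + (d - 1)) = 0"
  shows "real N * (L * \<alpha> / l)\<^sup>2 / 16 \<le> (SubOpt_NC (2 * N * d) L (hard_obj N d l L \<alpha>) (consensus_set N d) x)\<^sup>2"
proof -
  let ?n = "2 * N" and ?g = "hard_grad N d l L \<alpha>"
  let ?m = "block_mean ?n d x"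
  define c where "c = consensus_vec ?n d ?m"
  have n: "?n > 0" using N by simp
  have c: "c \<in> carrier_vec (?n * d)" by (simp add: c_def)
  have "?m (d - 1) = 0" using last by (simp add: block_mean_def)
  then obtain j where j: "j < d" and mean_c: "L * \<alpha> / (2 * l) \<le> \<bar>block_mean ?n d (?g c) j\<bar>"
    using hard_grad_consensus_large[OF N d \<alpha> l L] unfolding c_def by blast
  define R where "R = (euclid_norm (x - c))\<^sup>2"
  define y where "y = x - (1 / (2 * L)) \<cdot>\<^sub>v ?g x"
  define S where "S = (euclid_norm (x - euclid_proj (consensus_set N d) y))\<^sup>2"
  define a where "a = block_mean ?n d (?g x) j"
  define e where "e = block_mean ?n d (?g c) j"
  have y: "y \<in> carrier_vec (?n * d)" using x by (simp add: y_def)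
  have mean_y: "block_mean ?n d y q = ?m q - block_mean ?n d (?g x) q / (2 * L)" if "q < d" for q
  proof -
    have "y $ (b * d + q) = x $ (b * d + q) - ?g x $ (b * d + q) / (2 * L)" if "b < ?n" for b
      using x block_index_less[OF that \<open>q < d\<close>]
      by (simp add: y_def)
    then have "(\<Sum>b<?n. y $ (b * d + q))
        = (\<Sum>b<?n. x $ (b * d + q)) - (\<Sum>b<?n. ?g x $ (b * d + q)) / (2 * L)"
      by (simp add: sum_subtractf sum_divide_distrib)
    then show ?thesis by (simp add: block_mean_def diff_divide_distrib)
  qed
  have "S = R + real ?n * (\<Sum>q<d. (?m q - block_mean ?n d y q)\<^sup>2)"
    unfolding S_def R_def c_def euclid_proj_consensus_set[OF N y]
    by (rule euclid_norm_consensus_decomp[OF n x])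
  moreover have "(?m j - block_mean ?n d y j)\<^sup>2 \<le> (\<Sum>q<d. (?m q - block_mean ?n d y q)\<^sup>2)"
    using j by (intro member_le_sum) auto
  moreover have "(?m j - block_mean ?n d y j)\<^sup>2 = (a / (2 * L))\<^sup>2"
    using mean_y[OF j] by (simp add: a_def)
  ultimately have S1: "R + real ?n * (a / (2 * L))\<^sup>2 \<le> S"
    by (simp add: mult_left_mono)
  have "R + real ?n * (a / (2 * L))\<^sup>2 = R + real ?n * a\<^sup>2 / (4 * L\<^sup>2)"
    by (simp add: power_divide power_mult_distrib)
  then have S2: "4 * L\<^sup>2 * R + real ?n * a\<^sup>2 \<le> 4 * L\<^sup>2 * S"
    using mult_left_mono[OF S1, of "4 * L\<^sup>2"] L by (simp add: distrib_left)
  \<comment> \<open>Averaging over blocks does not increase the norm of the gradient difference, and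
    the gradient is Lipschitz.\<close>
  have diff: "real ?n * (a - e)\<^sup>2 \<le> L\<^sup>2 * R"
  proof -
    let ?h = "?g x - ?g c"
    have h: "?h \<in> carrier_vec (?n * d)" by simp
    have mean_h: "block_mean ?n d ?h j = a - e"
    proof -
      have "?h $ (b * d + j) = ?g x $ (b * d + j) - ?g c $ (b * d + j)" if "b < ?n" for b
        using block_index_less[OF that j] by simp
      then show ?thesis by (simp add: a_def e_def block_mean_def sum_subtractf diff_divide_distrib)
    qed
    have "consensus_vec ?n d (\<lambda>_. 0) = 0\<^sub>v (?n * d)"
      by (rule eq_vec_blocksI[of _ ?n d]) (auto simp: block_index_less)
    then have "?h - consensus_vec ?n d (\<lambda>_. 0) = ?h" using h by (simp add: minus_zero_vec)
    then have "(euclid_norm ?h)\<^sup>2 = (euclid_norm (?h - consensus_vec ?n d (block_mean ?n d ?h)))\<^sup>2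
        + real ?n * (\<Sum>q<d. (block_mean ?n d ?h q - 0)\<^sup>2)"
      using euclid_norm_consensus_decomp[OF n h, of "\<lambda>_. 0"] by simp
    moreover have "(block_mean ?n d ?h j - 0)\<^sup>2 \<le> (\<Sum>q<d. (block_mean ?n d ?h q - 0)\<^sup>2)"
      using j by (intro member_le_sum) auto
    then have "real ?n * (a - e)\<^sup>2 \<le> real ?n * (\<Sum>q<d. (block_mean ?n d ?h q - 0)\<^sup>2)"
      unfolding mean_h by (intro mult_left_mono) auto
    moreover have "0 \<le> (euclid_norm (?h - consensus_vec ?n d (block_mean ?n d ?h)))\<^sup>2" by simp
    ultimately have "real ?n * (a - e)\<^sup>2 \<le> (euclid_norm ?h)\<^sup>2" by linarith
    also have "\<dots> \<le> (L * euclid_norm (x - c))\<^sup>2"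
      by (intro power_mono hard_grad_lipschitz smooth l d \<alpha> L x c) simp
    finally show ?thesis by (simp add: R_def power_mult_distrib)
  qed
  \<comment> \<open>The weights fit S2: doubling S2 controls the averaged gradient at x and leaves 8
    L\<open>\<^sup>2\<close> R, more than the 2 L\<open>\<^sup>2\<close> R lost in passing to
    c.\<close>
  have "e\<^sup>2 \<le> 2 * a\<^sup>2 + 2 * (a - e)\<^sup>2"
    using zero_le_power2[of "2 * a - e"] by (simp add: power2_eq_square algebra_simps)
  then have "real ?n * e\<^sup>2 \<le> real ?n * (2 * a\<^sup>2 + 2 * (a - e)\<^sup>2)" by (rule mult_left_mono) simp
  then have "real ?n * e\<^sup>2 \<le> 2 * (real ?n * a\<^sup>2) + 2 * (real ?n * (a - e)\<^sup>2)"
    by (simp only: distrib_left mult_ac)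
  moreover have "0 \<le> L\<^sup>2 * R" by (simp add: R_def)
  ultimately have "real ?n * e\<^sup>2 \<le> 8 * (L\<^sup>2 * S)" using S2 diff by linarith
  moreover have "(L * \<alpha> / (2 * l))\<^sup>2 \<le> e\<^sup>2"
    using mean_c l L \<alpha> by (subst power2_abs[of e, symmetric]) (intro power_mono, auto simp: e_def)
  then have "real ?n * (L * \<alpha> / (2 * l))\<^sup>2 \<le> real ?n * e\<^sup>2" by (rule mult_left_mono) simp
  moreover have "real ?n * (L * \<alpha> / (2 * l))\<^sup>2 = 8 * (real N * (L * \<alpha> / l)\<^sup>2 / 16)"
    by (simp add: power_divide power_mult_distrib)
  ultimately have "real N * (L * \<alpha> / l)\<^sup>2 / 16 \<le> L\<^sup>2 * S" by linarith
  also have "L\<^sup>2 * S = (SubOpt_NC (2 * N * d) L (hard_obj N d l L \<alpha>) (consensus_set N d) x)\<^sup>2"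
    using \<alpha> by (simp add: SubOpt_NC_def S_def y_def gradient_hard_obj[OF x d] power_mult_distrib)
  finally show ?thesis .
qed

section \<open>Choice of the parameters and the final bound\<close>

text \<open>The dimension is squeezed from both sides: it must be large enough that the last
  coordinate is not reached in k steps, and at most a multiple of k / \<kappa> for the rate. The
  factor 5 is 2 from N + 1 >= \<kappa> / 2 plus 3 from rounding and shifts, as k / \<kappa> is at
  least 1.\<close>

lemma hard_instance_parameters:
  fixes \<kappa> :: real and k :: nat
  assumes \<kappa>: "\<kappa> \<ge> 1" and k: "real k \<ge> \<kappa>"
    and N: "N = nat \<lfloor>(\<kappa> + 1) / 2\<rfloor>"
    and d: "d = nat (\<lfloor>(real k - 2) / (real N + 1)\<rfloor> + 1 + 2)"
  shows "1 \<le> N" "2 * real N - 1 \<le> \<kappa>" "1 \<le> d" "real d \<le> 5 * real k / \<kappa>"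
    "k + N \<le> (d - 1) * (N + 1)"
proof -
  define z where "z = \<lfloor>(\<kappa> + 1) / 2\<rfloor>"
  have Nz: "N = nat z" using N by (simp add: z_def)
  have fl: "1 \<le> z" using \<kappa> by (simp add: z_def le_floor_iff)
  then show "1 \<le> N" using Nz by simp
  have "real N = of_int z" using fl Nz by simp
  then have le: "real N \<le> (\<kappa> + 1) / 2" and less: "(\<kappa> + 1) / 2 < real N + 1"
    unfolding z_def by linarith+
  show "2 * real N - 1 \<le> \<kappa>" using le by simp
  have N\<kappa>: "\<kappa> / 2 \<le> real N + 1" using less by simp
  define q where "q = (real k - 2) / (real N + 1)"
  have k1: "1 \<le> real k" using \<kappa> k by linarith
  have "- 1 \<le> q"
    unfolding q_def using k1 by (subst pos_le_divide_eq) auto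
  \<comment> \<open>For k = 1 the floor is -1, so d must be formed in the integers before
    truncation; it is still at least 2.\<close>
  then have flq: "- 1 \<le> \<lfloor>q\<rfloor>" by (simp add: le_floor_iff)
  have rd: "real d = of_int \<lfloor>q\<rfloor> + 3" and rd1: "real (d - 1) = of_int \<lfloor>q\<rfloor> + 2"
    and d1: "1 \<le> d"
    using flq d by (simp_all add: q_def[symmetric] of_nat_diff)
  show "1 \<le> d" by (rule d1)
  have "q \<le> real k / (real N + 1)" unfolding q_def by (intro divide_right_mono) auto
  also have "\<dots> \<le> real k / (\<kappa> / 2)" using N\<kappa> \<kappa> by (intro divide_left_mono) auto
  finally have "q \<le> 2 * (real k / \<kappa>)" by (simp add: mult.commute)
  moreover have "1 \<le> real k / \<kappa>" using \<kappa> k by simp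
  ultimately have "q + 3 \<le> 5 * (real k / \<kappa>)" by linarith
  then show "real d \<le> 5 * real k / \<kappa>" unfolding rd by (simp, linarith)
  \<comment> \<open>The floor loses less than one, which yields k + N - 1 < (d - 1) (N + 1) over the
    reals; integrality gains the missing unit.\<close>
  have "q < of_int \<lfloor>q\<rfloor> + 1" by linarith
  then have "real k - 2 < (of_int \<lfloor>q\<rfloor> + 1) * (real N + 1)"
    unfolding q_def by (subst (asm) pos_divide_less_eq) auto
  then have "real k + real N - 1 < real (d - 1) * (real N + 1)"
    unfolding rd1 by (simp add: algebra_simps)
  then have "real (k + N) < real ((d - 1) * (N + 1) + 1)"
    unfolding of_nat_add of_nat_mult of_nat_1 by linarith
  then have "k + N < (d - 1) * (N + 1) + 1" by (simp only: of_nat_less_iff)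
  then show "k + N \<le> (d - 1) * (N + 1)" by linarith
qed

lemma hard_instance_lower_bound:
  fixes \<kappa> :: real and k :: nat
  assumes smooth: "\<And>d. 1 \<le> d \<Longrightarrow> G0_smooth d l" and l: "l > 0" and L: "L > 0" and \<Delta>: "\<Delta> > 0"
    and \<kappa>: "\<kappa> \<ge> 1" and k: "real k \<ge> \<kappa>"
    and N: "N = nat \<lfloor>(\<kappa> + 1) / 2\<rfloor>"
    and d: "d = nat (\<lfloor>(real k - 2) / (real N + 1)\<rfloor> + 1 + 2)"
    and \<alpha>: "\<alpha> = sqrt (l * \<Delta> / (12 * real N * real d * L))"
  shows "(hard_obj N d l L \<alpha>, set_indicator {0\<^sub>v ((2 * N - 1) * d)}, consensus_mat N d,
      0\<^sub>v ((2 * N - 1) * d), 0\<^sub>v (2 * N * d)) \<in> F_NC L \<Delta> \<kappa>"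
    and "linear_span_iterates (hard_obj N d l L \<alpha>) (consensus_mat N d) (0\<^sub>v ((2 * N - 1) * d)) x \<Longrightarrow>
      sqrt (1 / (960 * l)) * sqrt (\<kappa> * L * \<Delta> / real k)
      \<le> SubOpt_NC (2 * N * d) L (hard_obj N d l L \<alpha>) (consensus_set N d) (x k)"
proof -
  note par = hard_instance_parameters[OF \<kappa> k N d]
  have pos: "0 < real N" "0 < real d" using par by auto
  have a_arg: "0 < l * \<Delta> / (12 * real N * real d * L)" using l L \<Delta> pos by simp
  then have \<alpha>0: "\<alpha> > 0" unfolding \<alpha> by simp
  have \<alpha>2: "\<alpha>\<^sup>2 = l * \<Delta> / (12 * real N * real d * L)" using a_arg unfolding \<alpha> by simp
  \<comment> \<open>The function gap budget is used up exactly.\<close>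
  have "L * \<alpha>\<^sup>2 / l * (12 * real N * real d) = \<Delta>"
    unfolding \<alpha>2 using l L pos by (simp add: field_simps)
  then show "(hard_obj N d l L \<alpha>, set_indicator {0\<^sub>v ((2 * N - 1) * d)}, consensus_mat N d,
      0\<^sub>v ((2 * N - 1) * d), 0\<^sub>v (2 * N * d)) \<in> F_NC L \<Delta> \<kappa>"
    using smooth par l L \<alpha>0 by (intro hard_instance_in_F_NC) auto
  assume iter: "linear_span_iterates (hard_obj N d l L \<alpha>) (consensus_mat N d) (0\<^sub>v ((2 * N - 1) * d)) x"
  have "x k \<in> span_set (hard_obj N d l L \<alpha>) (consensus_mat N d) (0\<^sub>v ((2 * N - 1) * d)) x k"
    using iter by (simp add: linear_span_iterates_def)
  from span_set_zero_chain[OF par(3) _ iter this] \<alpha>0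
  have xk: "x k \<in> carrier_vec (2 * N * d)"
    and zero: "\<And>b q. b < 2 * N \<Longrightarrow> q < d \<Longrightarrow> k + N < q * (N + 1) + b + 1 \<Longrightarrow> x k $ (b * d + q) = 0"
    by auto
  \<comment> \<open>Block 0 is the critical one, since it sees each coordinate with the smallest
    delay.\<close>
  have last: "x k $ (b * d + (d - 1)) = 0" if "b < 2 * N" for b
    using par(3,5) that by (intro zero) auto
  let ?S = "SubOpt_NC (2 * N * d) L (hard_obj N d l L \<alpha>) (consensus_set N d) (x k)"
  have "\<kappa> * real d \<le> 5 * real k" using par(4) \<kappa> by (simp add: field_simps)
  then have "\<kappa> / (5 * real k) \<le> 1 / real d" using pos k \<kappa> by (simp add: field_simps)
  then have "L * \<Delta> / (192 * l) * (\<kappa> / (5 * real k)) \<le> L * \<Delta> / (192 * l) * (1 / real d)"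
    using l L \<Delta> by (intro mult_left_mono) auto
  \<comment> \<open>Here N cancels; 192 = 12 * 16 joins the constant of \<alpha> with that of the
    stationarity bound, and the factor 5 from d makes it 960.\<close>
  also have "\<dots> = real N * (L * \<alpha> / l)\<^sup>2 / 16"
    unfolding power_mult_distrib power_divide \<alpha>2 using l L pos
    by (simp add: field_simps power2_eq_square)
  also have "\<dots> \<le> ?S\<^sup>2"
    by (rule SubOpt_NC_hard_obj_ge[OF smooth[OF par(3)] par(1,3) \<alpha>0 l L xk last])
  finally have "1 / (960 * l) * (\<kappa> * L * \<Delta> / real k) \<le> ?S\<^sup>2" by (simp add: field_simps)
  moreover have "0 \<le> ?S" using L by (simp add: SubOpt_NC_def)
  ultimately show "sqrt (1 / (960 * l)) * sqrt (\<kappa> * L * \<Delta> / real k) \<le> ?S"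
    unfolding real_sqrt_mult[symmetric] by (intro real_le_lsqrt)
qed

text \<open>The first conjunct ensures that the second, stated for every admissible
  \<open>l\<^sub>0\<close>, is not vacuous. The constant \<open>c\<^sub>0\<close> is chosen after
  \<open>l\<^sub>0\<close> and before all other parameters.\<close>

theorem theorem5:
  shows "(\<exists>l\<^sub>0>0. \<forall>d\<ge>1. G0_smooth d l\<^sub>0) \<and>
    (\<forall>l\<^sub>0>0. (\<forall>d\<ge>1. G0_smooth d l\<^sub>0) \<longrightarrow>
      (\<exists>c\<^sub>0>0. \<forall>L\<^sub>f>0. \<forall>\<Delta>>0. \<forall>\<kappa>\<ge>1. \<forall>k::nat. real k \<ge> \<kappa> \<longrightarrow>
        (let N = nat \<lfloor>(\<kappa> + 1) / 2\<rfloor>;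
             K = \<lfloor>(real k - 2) / (real N + 1)\<rfloor> + 1;
             d = nat (K + 2);
             \<alpha> = sqrt (l\<^sub>0 * \<Delta> / (12 * real N * real d * L\<^sub>f));
             f = hard_obj N d l\<^sub>0 L\<^sub>f \<alpha>;
             A = consensus_mat N d;
             b = 0\<^sub>v ((2 * N - 1) * d);
             x\<^sub>0 = 0\<^sub>v (2 * N * d)
         in (f, set_indicator {0\<^sub>v ((2 * N - 1) * d)}, A, b, x\<^sub>0) \<in> F_NC L\<^sub>f \<Delta> \<kappa> \<and>
            (\<forall>x. linear_span_iterates f A b x \<longrightarrow>
               SubOpt_NC (2 * N * d) L\<^sub>f f (consensus_set N d) (x k)
                 \<ge> c\<^sub>0 * sqrt (\<kappa> * L\<^sub>f * \<Delta> / real k)))))"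
proof (intro conjI allI impI)
  have "0 < 4 * dbound\<^sup>2" by (simp add: dbound_def)
  then show "\<exists>l\<^sub>0>0. \<forall>d\<ge>1. G0_smooth d l\<^sub>0" using G0_smooth_dbound by blast
next
  fix l :: real assume l: "l > 0" and "\<forall>d\<ge>1. G0_smooth d l"
  then have smooth: "\<And>d. 1 \<le> d \<Longrightarrow> G0_smooth d l" by simp
  have c0: "0 < sqrt (1 / (960 * l))" using l by simp
  show "\<exists>c\<^sub>0>0. \<forall>L\<^sub>f>0. \<forall>\<Delta>>0. \<forall>\<kappa>\<ge>1. \<forall>k::nat. real k \<ge> \<kappa> \<longrightarrow>
        (let N = nat \<lfloor>(\<kappa> + 1) / 2\<rfloor>;
             K = \<lfloor>(real k - 2) / (real N + 1)\<rfloor> + 1;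
             d = nat (K + 2);
             \<alpha> = sqrt (l * \<Delta> / (12 * real N * real d * L\<^sub>f));
             f = hard_obj N d l L\<^sub>f \<alpha>;
             A = consensus_mat N d;
             b = 0\<^sub>v ((2 * N - 1) * d);
             x\<^sub>0 = 0\<^sub>v (2 * N * d)
         in (f, set_indicator {0\<^sub>v ((2 * N - 1) * d)}, A, b, x\<^sub>0) \<in> F_NC L\<^sub>f \<Delta> \<kappa> \<and>
            (\<forall>x. linear_span_iterates f A b x \<longrightarrow>
               SubOpt_NC (2 * N * d) L\<^sub>f f (consensus_set N d) (x k)
                 \<ge> c\<^sub>0 * sqrt (\<kappa> * L\<^sub>f * \<Delta> / real k)))"
    unfolding Let_def
    by (intro exI[of _ "sqrt (1 / (960 * l))"] conjI allI impI)
      (rule c0 | (rule hard_instance_lower_bound[OF smooth l _ _ _ _ refl refl refl]; assumption))+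
qed

end
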